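(* Let $T$ be a set and $F$ a field. The functor $K\colon\mathbf{Vect}^{T\text{-}\mathrm{gr}}_F\to\mathbf{NAAlg}^{T\text{-}\mathrm{pgr}}_F$ is left adjoint to the forgetful functor $U\colon\mathbf{NAAlg}^{T\text{-}\mathrm{pgr}}_F\to\mathbf{Vect}^{T\text{-}\mathrm{gr}}_F$.
   Context: $\mathbf{Vect}^{T\text{-}\mathrm{gr}}_F$ is the category whose objects are $T$-graded vector spaces over $F$, i.e. vector spaces $V$ with a fixed decomposition $V=\bigoplus_{t\in T}V^{(t)}$, and whose morphisms $V\to W$ are the linear maps $\varphi$ with $\varphi(V^{(t)})\subseteq W^{(t)}$ for all $t\in T$. $\mathbf{NAAlg}^{T\text{-}\mathrm{pgr}}_F$ is the category whose objects are not necessarily associative $F$-algebras $A$ with a distinguished subspace $\bigoplus_{t\in T}A^{(t)}\subseteq A$ (the inclusion may be proper) graded by $T$ as a vector space, and whose morphisms $A\to B$ are the algebra homomorphisms $\varphi\colon A\to B$ with $\varphi(A^{(t)})\subseteq B^{(t)}$ for every $t\in T$. $U$ sends an object $A\supseteq\bigoplus_{t\in T}A^{(t)}$ to the $T$-graded vector space $\bigoplus_{t\in T}A^{(t)}$ and restricts homomorphisms to the distinguished subspaces. For a $T$-graded space $V=\bigoplus_{t\in T}V^{(t)}$, $KV$ is the absolutely free non-associative algebra on a basis $Y=\bigsqcup_{t\in T}Y^{(t)}$ of $V$, where $Y^{(t)}$ is a basis of $V^{(t)}$; equivalently $KV=\bigoplus_{n=1}^\infty\bigoplus_{\text{arrangements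 of brackets}}V^{\otimes n}$ with multiplication $vw=v\otimes w$ (with the corresponding bracket arrangement). $V$ is identified with the degree $1$ part of $KV$, and $KV\supseteq V=\bigoplus_{t\in T}V^{(t)}$ is regarded as an object of $\mathbf{NAAlg}^{T\text{-}\mathrm{pgr}}_F$. For a morphism $\varphi\colon V\to W$, $K\varphi\colon KV\to KW$ is the unique algebra homomorphism with $(K\varphi)|_V=\varphi$. *)

theory Defs
  imports "HOL-Algebra.Module" "HOL-Library.FuncSet" "HOL-Library.Equipollence"
begin

section \<open>Categories, functors, adjunctions\<close>

text \<open>
  Hom-sets need not be pairwise disjoint; identities and composition are therefore indexed
  by the objects involved.  \<open>Comp C X Y Z g f\<close> is the composite of \<open>f : X \<rightarrow> Y\<close> and
  \<open>g : Y \<rightarrow> Z\<close>.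
\<close>

record ('o, 'm) cat =
  Obj :: "'o set"
  Hom :: "'o \<Rightarrow> 'o \<Rightarrow> 'm set"
  Ide :: "'o \<Rightarrow> 'm"
  Comp :: "'o \<Rightarrow> 'o \<Rightarrow> 'o \<Rightarrow> 'm \<Rightarrow> 'm \<Rightarrow> 'm"

definition is_category :: "('o, 'm) cat \<Rightarrow> bool" where
  "is_category C \<longleftrightarrow>
     (\<forall>X\<in>Obj C. Ide C X \<in> Hom C X X) \<and>
     (\<forall>X\<in>Obj C. \<forall>Y\<in>Obj C. \<forall>Z\<in>Obj C. \<forall>f\<in>Hom C X Y. \<forall>g\<in>Hom C Y Z.
        Comp C X Y Z g f \<in> Hom C X Z) \<and>
     (\<forall>X\<in>Obj C. \<forall>Y\<in>Obj C. \<forall>f\<in>Hom C X Y.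
        Comp C X X Y f (Ide C X) = f \<and> Comp C X Y Y (Ide C Y) f = f) \<and>
     (\<forall>W\<in>Obj C. \<forall>X\<in>Obj C. \<forall>Y\<in>Obj C. \<forall>Z\<in>Obj C.
        \<forall>f\<in>Hom C W X. \<forall>g\<in>Hom C X Y. \<forall>h\<in>Hom C Y Z.
        Comp C W Y Z h (Comp C W X Y g f) = Comp C W X Z (Comp C X Y Z h g) f)"

record ('o, 'm, 'p, 'n) fctr =
  on_obj :: "'o \<Rightarrow> 'p"
  on_hom :: "'o \<Rightarrow> 'o \<Rightarrow> 'm \<Rightarrow> 'n"

definition is_functor ::
    "('o, 'm) cat \<Rightarrow> ('p, 'n) cat \<Rightarrow> ('o, 'm, 'p, 'n) fctr \<Rightarrow> bool" where
  "is_functor C D L \<longleftrightarrow> is_category C \<and> is_category D \<and>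
     (\<forall>X\<in>Obj C. on_obj L X \<in> Obj D) \<and>
     (\<forall>X\<in>Obj C. \<forall>Y\<in>Obj C. \<forall>f\<in>Hom C X Y.
        on_hom L X Y f \<in> Hom D (on_obj L X) (on_obj L Y)) \<and>
     (\<forall>X\<in>Obj C. on_hom L X X (Ide C X) = Ide D (on_obj L X)) \<and>
     (\<forall>X\<in>Obj C. \<forall>Y\<in>Obj C. \<forall>Z\<in>Obj C. \<forall>f\<in>Hom C X Y. \<forall>g\<in>Hom C Y Z.
        on_hom L X Z (Comp C X Y Z g f) =
        Comp D (on_obj L X) (on_obj L Y) (on_obj L Z) (on_hom L Y Z g) (on_hom L X Y f))"

text \<open>
  \<open>left_adjoint C D L R\<close>: the functor \<open>L : C \<rightarrow> D\<close> is left adjoint to \<open>R : D \<rightarrow> C\<close>, i.e. there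
  are bijections \<open>Hom D (L X) A \<cong> Hom C X (R A)\<close>, natural in both arguments.
\<close>

definition left_adjoint ::
    "('o, 'm) cat \<Rightarrow> ('p, 'n) cat \<Rightarrow> ('o, 'm, 'p, 'n) fctr \<Rightarrow> ('p, 'n, 'o, 'm) fctr \<Rightarrow> bool" where
  "left_adjoint C D L R \<longleftrightarrow> is_functor C D L \<and> is_functor D C R \<and>
     (\<exists>\<Phi>.
       (\<forall>X\<in>Obj C. \<forall>A\<in>Obj D. bij_betw (\<Phi> X A) (Hom D (on_obj L X) A) (Hom C X (on_obj R A))) \<and>
       (\<forall>X\<in>Obj C. \<forall>X'\<in>Obj C. \<forall>A\<in>Obj D. \<forall>A'\<in>Obj D.
          \<forall>f\<in>Hom C X' X. \<forall>g\<in>Hom D A A'. \<forall>h\<in>Hom D (on_obj L X) A.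
          \<Phi> X' A'
            (Comp D (on_obj L X') A A' g (Comp D (on_obj L X') (on_obj L X) A h (on_hom L X' X f))) =
          Comp C X' (on_obj R A) (on_obj R A') (on_hom R A A' g)
            (Comp C X' X (on_obj R A) (\<Phi> X A h) f)))"


section \<open>Graded spaces and partially graded algebras\<close>

text \<open>
  The field \<open>one\<close> of a module record is never used, and \<open>mult\<close> is used only when the record is
  considered as an algebra; likewise only the values of \<open>grade\<close> on \<open>T\<close> matter.
  These unused components are unconstrained, so a given graded space is represented by several
  isomorphic objects.
\<close>

record ('f, 'u, 't) graded_module = "('f, 'u) module" +
  grade :: "'t \<Rightarrow> 'u set"

definition lin_maps ::
    "('f, 'r) ring_scheme \<Rightarrow> ('f, 'u, 'v) module_scheme \<Rightarrow> ('f, 'w, 'x) module_scheme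
      \<Rightarrow> ('u \<Rightarrow> 'w) set" where
  "lin_maps F V W = {\<phi> \<in> carrier V \<rightarrow>\<^sub>E carrier W.
     (\<forall>x\<in>carrier V. \<forall>y\<in>carrier V. \<phi> (x \<oplus>\<^bsub>V\<^esub> y) = \<phi> x \<oplus>\<^bsub>W\<^esub> \<phi> y) \<and>
     (\<forall>a\<in>carrier F. \<forall>x\<in>carrier V. \<phi> (a \<odot>\<^bsub>V\<^esub> x) = a \<odot>\<^bsub>W\<^esub> \<phi> x)}"

definition alg_homs ::
    "('f, 'r) ring_scheme \<Rightarrow> ('f, 'u, 'v) module_scheme \<Rightarrow> ('f, 'w, 'x) module_scheme
      \<Rightarrow> ('u \<Rightarrow> 'w) set" where
  "alg_homs F A B = {\<phi> \<in> lin_maps F A B.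
     \<forall>x\<in>carrier A. \<forall>y\<in>carrier A. \<phi> (x \<otimes>\<^bsub>A\<^esub> y) = \<phi> x \<otimes>\<^bsub>B\<^esub> \<phi> y}"

definition grade_preserving ::
    "'t set \<Rightarrow> ('f, 'u, 't, 'v) graded_module_scheme \<Rightarrow> ('f, 'w, 't, 'x) graded_module_scheme
      \<Rightarrow> ('u \<Rightarrow> 'w) \<Rightarrow> bool" where
  "grade_preserving T V W \<phi> \<longleftrightarrow> (\<forall>t\<in>T. \<phi> ` grade V t \<subseteq> grade W t)"

definition grade_families ::
    "'t set \<Rightarrow> ('f, 'u, 't, 'v) graded_module_scheme \<Rightarrow> ('t \<Rightarrow> 'u) set" where
  "grade_families T V = {x. (\<forall>t\<in>T. x t \<in> grade V t) \<and> (\<forall>t. t \<notin> T \<longrightarrow> x t = \<zero>\<^bsub>V\<^esub>) \<and>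
     finite {t. x t \<noteq> \<zero>\<^bsub>V\<^esub>}}"

definition family_sum :: "('f, 'u, 't, 'v) graded_module_scheme \<Rightarrow> ('t \<Rightarrow> 'u) \<Rightarrow> 'u" where
  "family_sum V x = finsum V x {t. x t \<noteq> \<zero>\<^bsub>V\<^esub>}"

text \<open>\<open>grade_total T V\<close> is the sum of the subspaces \<open>grade V t\<close>, and \<open>direct_grading\<close> says that
  this sum is direct.\<close>

definition grade_total :: "'t set \<Rightarrow> ('f, 'u, 't, 'v) graded_module_scheme \<Rightarrow> 'u set" where
  "grade_total T V = family_sum V ` grade_families T V"

definition direct_grading ::
    "('f, 'r) ring_scheme \<Rightarrow> 't set \<Rightarrow> ('f, 'u, 't, 'v) graded_module_scheme \<Rightarrow> bool" where
  "direct_grading F T V \<longleftrightarrow>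
     (\<forall>t\<in>T. submodule (grade V t) F V) \<and> inj_on (family_sum V) (grade_families T V)"

definition graded_space ::
    "('f, 'r) ring_scheme \<Rightarrow> 't set \<Rightarrow> ('f, 'u, 't, 'v) graded_module_scheme \<Rightarrow> bool" where
  "graded_space F T V \<longleftrightarrow>
     module F V \<and> direct_grading F T V \<and> grade_total T V = carrier V"

definition nonassoc_algebra ::
    "('f, 'r) ring_scheme \<Rightarrow> ('f, 'u, 'v) module_scheme \<Rightarrow> bool" where
  "nonassoc_algebra F A \<longleftrightarrow> module F A \<and>
     (\<forall>x\<in>carrier A. \<forall>y\<in>carrier A. x \<otimes>\<^bsub>A\<^esub> y \<in> carrier A) \<and>
     (\<forall>x\<in>carrier A. \<forall>y\<in>carrier A. \<forall>z\<in>carrier A.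
        (x \<oplus>\<^bsub>A\<^esub> y) \<otimes>\<^bsub>A\<^esub> z = (x \<otimes>\<^bsub>A\<^esub> z) \<oplus>\<^bsub>A\<^esub> (y \<otimes>\<^bsub>A\<^esub> z) \<and>
        z \<otimes>\<^bsub>A\<^esub> (x \<oplus>\<^bsub>A\<^esub> y) = (z \<otimes>\<^bsub>A\<^esub> x) \<oplus>\<^bsub>A\<^esub> (z \<otimes>\<^bsub>A\<^esub> y)) \<and>
     (\<forall>a\<in>carrier F. \<forall>x\<in>carrier A. \<forall>y\<in>carrier A.
        (a \<odot>\<^bsub>A\<^esub> x) \<otimes>\<^bsub>A\<^esub> y = a \<odot>\<^bsub>A\<^esub> (x \<otimes>\<^bsub>A\<^esub> y) \<and>
        x \<otimes>\<^bsub>A\<^esub> (a \<odot>\<^bsub>A\<^esub> y) = a \<odot>\<^bsub>A\<^esub> (x \<otimes>\<^bsub>A\<^esub> y))"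

text \<open>The grading of the distinguished subspace is unrelated to the multiplication.\<close>

definition pgr_algebra ::
    "('f, 'r) ring_scheme \<Rightarrow> 't set \<Rightarrow> ('f, 'u, 't, 'v) graded_module_scheme \<Rightarrow> bool" where
  "pgr_algebra F T A \<longleftrightarrow> nonassoc_algebra F A \<and> direct_grading F T A"

text \<open>
  The objects are the small ones: those whose carrier is a set of elements of the type \<open>'u\<close>,
  which plays the role of the universe.  Arrows are extensional functions, so that equality of
  arrows is equality on the carrier of the source.
\<close>

definition Vect_gr ::
    "('f, 'r) ring_scheme \<Rightarrow> 't set \<Rightarrow> (('f, 'u, 't) graded_module, 'u \<Rightarrow> 'u) cat" where
  "Vect_gr F T = \<lparr>
     Obj = {V. graded_space F T V},
     Hom = (\<lambda>V W. {\<phi> \<in> lin_maps F V W. grade_preserving T V W \<phi>}),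
     Ide = (\<lambda>V. restrict id (carrier V)),
     Comp = (\<lambda>U V W \<psi> \<phi>. compose (carrier U) \<psi> \<phi>) \<rparr>"

definition NAAlg_pgr ::
    "('f, 'r) ring_scheme \<Rightarrow> 't set \<Rightarrow> (('f, 'u, 't) graded_module, 'u \<Rightarrow> 'u) cat" where
  "NAAlg_pgr F T = \<lparr>
     Obj = {A. pgr_algebra F T A},
     Hom = (\<lambda>A B. {\<phi> \<in> alg_homs F A B. grade_preserving T A B \<phi>}),
     Ide = (\<lambda>A. restrict id (carrier A)),
     Comp = (\<lambda>A B C \<psi> \<phi>. compose (carrier A) \<psi> \<phi>) \<rparr>"


section \<open>The forgetful functor\<close>

definition U_obj :: "'t set \<Rightarrow> ('f, 'u, 't) graded_module \<Rightarrow> ('f, 'u, 't) graded_module" where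
  "U_obj T A = A\<lparr>carrier := grade_total T A\<rparr>"

definition U_functor ::
    "'t set \<Rightarrow> (('f, 'u, 't) graded_module, 'u \<Rightarrow> 'u, ('f, 'u, 't) graded_module, 'u \<Rightarrow> 'u) fctr" where
  "U_functor T = \<lparr>
     on_obj = U_obj T,
     on_hom = (\<lambda>A B \<phi>. restrict \<phi> (grade_total T A)) \<rparr>"


section \<open>Bases\<close>

definition fin_coeffs :: "('f, 'r) ring_scheme \<Rightarrow> 'y set \<Rightarrow> ('y \<Rightarrow> 'f) set" where
  "fin_coeffs F Y = {c. (\<forall>y. c y \<in> carrier F) \<and> (\<forall>y. y \<notin> Y \<longrightarrow> c y = \<zero>\<^bsub>F\<^esub>) \<and>
     finite {y. c y \<noteq> \<zero>\<^bsub>F\<^esub>}}"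

definition lincomb ::
    "('f, 'r) ring_scheme \<Rightarrow> ('f, 'u, 'v) module_scheme \<Rightarrow> ('u \<Rightarrow> 'f) \<Rightarrow> 'u" where
  "lincomb F V c = finsum V (\<lambda>y. c y \<odot>\<^bsub>V\<^esub> y) {y. c y \<noteq> \<zero>\<^bsub>F\<^esub>}"

definition is_basis ::
    "('f, 'r) ring_scheme \<Rightarrow> ('f, 'u, 'v) module_scheme \<Rightarrow> 'u set \<Rightarrow> 'u set \<Rightarrow> bool" where
  "is_basis F V W Y \<longleftrightarrow> Y \<subseteq> W \<and>
     (\<forall>c\<in>fin_coeffs F Y. lincomb F V c = \<zero>\<^bsub>V\<^esub> \<longrightarrow> (\<forall>y\<in>Y. c y = \<zero>\<^bsub>F\<^esub>)) \<and>
     (\<forall>w\<in>W. \<exists>c\<in>fin_coeffs F Y. w = lincomb F V c)"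

text \<open>A homogeneous basis: the union of chosen bases of the components.\<close>

definition hom_basis ::
    "('f, 'r) ring_scheme \<Rightarrow> 't set \<Rightarrow> ('f, 'u, 't, 'v) graded_module_scheme \<Rightarrow> 'u set" where
  "hom_basis F T V = (\<Union>t\<in>T. SOME Y. is_basis F V (grade V t) Y)"

definition coords ::
    "('f, 'r) ring_scheme \<Rightarrow> ('f, 'u, 'v) module_scheme \<Rightarrow> 'u set \<Rightarrow> 'u \<Rightarrow> 'u \<Rightarrow> 'f" where
  "coords F V Y v = (THE c. c \<in> fin_coeffs F Y \<and> v = lincomb F V c)"


section \<open>The absolutely free non-associative algebra\<close>

text \<open>Nonempty bracketed words, i.e. the free magma.\<close>

datatype 'y bword = Gen 'y | Br "'y bword" "'y bword"

definition free_alg ::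
    "('f, 'r) ring_scheme \<Rightarrow> 'y set \<Rightarrow> ('f, 'y bword \<Rightarrow> 'f) module" where
  "free_alg F Y = \<lparr>
     carrier = fin_coeffs F {w. set_bword w \<subseteq> Y},
     mult = (\<lambda>p q w. case w of Gen y \<Rightarrow> \<zero>\<^bsub>F\<^esub> | Br w1 w2 \<Rightarrow> p w1 \<otimes>\<^bsub>F\<^esub> q w2),
     one = undefined,
     zero = (\<lambda>w. \<zero>\<^bsub>F\<^esub>),
     add = (\<lambda>p q w. p w \<oplus>\<^bsub>F\<^esub> q w),
     smult = (\<lambda>a p w. a \<otimes>\<^bsub>F\<^esub> p w) \<rparr>"

text \<open>
  For the free algebra on \<open>Y \<subseteq> UNIV :: 'u set\<close> to be an object again, its elements have to be
  coded by elements of \<open>'u\<close>.  Such a coding exists as soon as \<open>'u\<close> is infinite and the carrier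
  of \<open>F\<close> embeds into \<open>'u\<close>.  (Spaces and algebras on any type \<open>'a\<close> can be copied into such
  a type, e.g. into \<open>'a + 'f + nat\<close>.)
\<close>

definition encode :: "('f, 'r) ring_scheme \<Rightarrow> ('u bword \<Rightarrow> 'f) \<Rightarrow> 'u" where
  "encode F = (SOME e. inj_on e (carrier (free_alg F UNIV)))"

definition decode :: "('f, 'r) ring_scheme \<Rightarrow> 'u \<Rightarrow> ('u bword \<Rightarrow> 'f)" where
  "decode F = inv_into (carrier (free_alg F UNIV)) (encode F)"

text \<open>The identification of \<open>V\<close> with the degree 1 part of the free algebra.\<close>

definition K_incl ::
    "('f, 'r) ring_scheme \<Rightarrow> 't set \<Rightarrow> ('f, 'u, 't) graded_module \<Rightarrow> 'u \<Rightarrow> 'u" where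
  "K_incl F T V v = encode F (\<lambda>w. case w of
     Gen y \<Rightarrow> coords F V (hom_basis F T V) v y | Br w1 w2 \<Rightarrow> \<zero>\<^bsub>F\<^esub>)"

definition K_obj ::
    "('f, 'r) ring_scheme \<Rightarrow> 't set \<Rightarrow> ('f, 'u, 't) graded_module \<Rightarrow> ('f, 'u, 't) graded_module"
  where
  "K_obj F T V = (let M = free_alg F (hom_basis F T V) in \<lparr>
     carrier = encode F ` carrier M,
     mult = (\<lambda>x y. encode F (decode F x \<otimes>\<^bsub>M\<^esub> decode F y)),
     one = undefined,
     zero = encode F \<zero>\<^bsub>M\<^esub>,
     add = (\<lambda>x y. encode F (decode F x \<oplus>\<^bsub>M\<^esub> decode F y)),
     smult = (\<lambda>a x. encode F (a \<odot>\<^bsub>M\<^esub> decode F x)),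
     grade = (\<lambda>t. K_incl F T V ` grade V t) \<rparr>)"

definition K_hom ::
    "('f, 'r) ring_scheme \<Rightarrow> 't set \<Rightarrow> ('f, 'u, 't) graded_module \<Rightarrow> ('f, 'u, 't) graded_module
      \<Rightarrow> ('u \<Rightarrow> 'u) \<Rightarrow> 'u \<Rightarrow> 'u" where
  "K_hom F T V W \<phi> = (THE \<psi>. \<psi> \<in> alg_homs F (K_obj F T V) (K_obj F T W) \<and>
     (\<forall>v\<in>carrier V. \<psi> (K_incl F T V v) = K_incl F T W (\<phi> v)))"

definition K_functor ::
    "('f, 'r) ring_scheme \<Rightarrow> 't set
      \<Rightarrow> (('f, 'u, 't) graded_module, 'u \<Rightarrow> 'u, ('f, 'u, 't) graded_module, 'u \<Rightarrow> 'u) fctr" where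
  "K_functor F T = \<lparr> on_obj = K_obj F T, on_hom = K_hom F T \<rparr>"

end

theory Submission
  imports Defs
begin

text \<open>
  The composite with the inclusion of \<open>V\<close> as the degree 1 part of \<open>KV\<close> is the adjunction
  bijection.  It is bijective because a homomorphism out of the free algebra is determined by an arbitrary
  linear map on \<open>V\<close>: the bracketed words in a basis of \<open>V\<close> form a basis of \<open>KV\<close>, so evaluate words
  in \<open>A\<close> and extend linearly.  The grading enters only twice: a union of bases of the components is
  a basis of their direct sum, and a grade preserving map from \<open>V\<close> into an algebra lands in the
  distinguished subspace.
\<close>

section \<open>Linear combinations of indexed families\<close>

text \<open>Objects must have their carriers in the type \<open>'u\<close>, so \<open>KV\<close> is
  not the space of finitely supported functions on words itself but its image under a coding into
  \<open>'u\<close>. An infinite \<open>'u\<close> supplies a pairing function, which codes words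
  and finite lists; the embedding of the scalars codes the coefficients. Injectivity of the coding
  on all finitely supported functions is what the later steps use, and one coding serves every
  \<open>V\<close>. Since arrows are extensional functions, composites and restrictions have to be
  evaluated inside the right carrier, and a finite sum formed in \<open>U A\<close> is not literally
  the sum formed in \<open>A\<close>. Many identities between linear combinations are reduced, by
  additivity, to coefficient functions with at most one nonzero value. Inverses of scalars enter
  through the existence of bases, which comes from Zorn's lemma applied inside each
  component.\<close>

definition indexed_lincomb ::
    "('f, 'r) ring_scheme \<Rightarrow> ('f, 'u, 'v) module_scheme \<Rightarrow> ('i \<Rightarrow> 'u) \<Rightarrow> ('i \<Rightarrow> 'f) \<Rightarrow> 'u" where
  "indexed_lincomb F V g c = finsum V (\<lambda>i. c i \<odot>\<^bsub>V\<^esub> g i) {i. c i \<noteq> \<zero>\<^bsub>F\<^esub>}"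

definition single :: "('f, 'r) ring_scheme \<Rightarrow> 'i \<Rightarrow> 'f \<Rightarrow> 'i \<Rightarrow> 'f" where
  "single F i a = (\<lambda>j. if j = i then a else \<zero>\<^bsub>F\<^esub>)"

text \<open>A sum over a set of vectors would merge distinct words with the same value in an
  algebra; an indexed family keeps them apart. The identity family recovers the sums used for
  bases.\<close>

lemma lincomb_eq_indexed: "lincomb F V = indexed_lincomb F V (\<lambda>y. y)"
  by (simp add: fun_eq_iff lincomb_def indexed_lincomb_def)

lemma fin_coeffs_mono: "c \<in> fin_coeffs F I \<Longrightarrow> I \<subseteq> J \<Longrightarrow> c \<in> fin_coeffs F J"
  by (auto simp: fin_coeffs_def)

lemma fin_coeffs_supp: "c \<in> fin_coeffs F I \<Longrightarrow> {i. c i \<noteq> \<zero>\<^bsub>F\<^esub>} \<subseteq> I"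
  by (auto simp: fin_coeffs_def)

lemma single_zero [simp]: "single F i \<zero>\<^bsub>F\<^esub> = (\<lambda>_. \<zero>\<^bsub>F\<^esub>)"
  by (auto simp: single_def)

section \<open>Finitely supported coefficient functions\<close>

context cring
begin

lemma fin_coeffs_zero: "(\<lambda>_. \<zero>) \<in> fin_coeffs R I"
  by (simp add: fin_coeffs_def)

lemma fin_coeffs_single: "i \<in> I \<Longrightarrow> a \<in> carrier R \<Longrightarrow> single R i a \<in> fin_coeffs R I"
  by (auto simp: fin_coeffs_def single_def)

lemma fin_coeffs_add:
  assumes "c \<in> fin_coeffs R I" "d \<in> fin_coeffs R I"
  shows "(\<lambda>i. c i \<oplus> d i) \<in> fin_coeffs R I"
proof -
  have "{i. c i \<oplus> d i \<noteq> \<zero>} \<subseteq> {i. c i \<noteq> \<zero>} \<union> {i. d i \<noteq> \<zero>}" by auto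
  then show ?thesis using assms by (auto simp: fin_coeffs_def intro: finite_subset)
qed

lemma fin_coeffs_smult:
  assumes "c \<in> fin_coeffs R I" "a \<in> carrier R"
  shows "(\<lambda>i. a \<otimes> c i) \<in> fin_coeffs R I"
proof -
  have "{i. a \<otimes> c i \<noteq> \<zero>} \<subseteq> {i. c i \<noteq> \<zero>}" using assms by auto
  then show ?thesis using assms by (auto simp: fin_coeffs_def intro: finite_subset)
qed

text \<open>Peel off one index of the finite support at a time. Later proofs use this in place of
  manipulating finite sums: a property that is stable under addition of coefficients has to be
  checked on one-term functions only. The zero function is a case of its own because
  \<open>I\<close> may be empty.\<close>

lemma fin_coeffs_induct [consumes 1, case_names zero single add]:
  fixes P :: "('i \<Rightarrow> 'a) \<Rightarrow> bool"
  assumes "c \<in> fin_coeffs R I"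
    and zero: "P (\<lambda>_. \<zero>)"
    and single: "\<And>i a. i \<in> I \<Longrightarrow> a \<in> carrier R \<Longrightarrow> P (single R i a)"
    and add: "\<And>c d. c \<in> fin_coeffs R I \<Longrightarrow> d \<in> fin_coeffs R I \<Longrightarrow> P c \<Longrightarrow> P d
      \<Longrightarrow> P (\<lambda>i. c i \<oplus> d i)"
  shows "P c"
proof -
  have "finite S \<Longrightarrow> \<forall>c. c \<in> fin_coeffs R I \<longrightarrow> {i. c i \<noteq> \<zero>} = S \<longrightarrow> P c" for S
  proof (induction S rule: finite_induct)
    case empty
    show ?case
    proof (intro allI impI)
      fix c :: "'i \<Rightarrow> 'a" assume "{i. c i \<noteq> \<zero>} = {}"
      then have "c = (\<lambda>_. \<zero>)" by auto
      then show "P c" using zero by simp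
    qed
  next
    case (insert s S)
    show ?case
    proof (intro allI impI)
      fix c assume c: "c \<in> fin_coeffs R I" and supp: "{i. c i \<noteq> \<zero>} = insert s S"
      \<comment> \<open>Erasing the coefficient at \<open>s\<close> leaves support \<open>S\<close>,
        and adding back a one-term function recovers \<open>c\<close>.\<close>
      let ?d = "c(s := \<zero>)"
      have suppd: "{i. ?d i \<noteq> \<zero>} = S" using supp insert.hyps by (auto split: if_splits)
      have d: "?d \<in> fin_coeffs R I"
        using c suppd insert.hyps by (auto simp: fin_coeffs_def)
      have s: "s \<in> I" "c s \<in> carrier R" using c supp by (auto simp: fin_coeffs_def)
      have "c = (\<lambda>i. ?d i \<oplus> single R s (c s) i)"
        using c by (auto simp: single_def fin_coeffs_def fun_eq_iff)
      moreover have "P (\<lambda>i. ?d i \<oplus> single R s (c s) i)"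
        using add[OF d fin_coeffs_single[OF s]] insert.IH d suppd single s by blast
      ultimately show "P c" by simp
    qed
  qed
  then show ?thesis using assms(1) by (auto simp: fin_coeffs_def)
qed

end

section \<open>Linear combinations and submodules in a fixed module\<close>

context module
begin

text \<open>Supports change under addition and scaling, since coefficients may cancel. Sums can be
  compared only after they are taken over a common finite index set, which has to stay inside
  \<open>I\<close>, where \<open>g\<close> is known to take values in the carrier.\<close>

lemma indexed_lincomb_superset:
  assumes "c \<in> fin_coeffs R I" "g \<in> I \<rightarrow> carrier M" "finite S" "{i. c i \<noteq> \<zero>} \<subseteq> S" "S \<subseteq> I"
  shows "indexed_lincomb R M g c = finsum M (\<lambda>i. c i \<odot>\<^bsub>M\<^esub> g i) S"
  unfolding indexed_lincomb_def
  using assms subsetD[OF assms(5), THEN funcset_mem[OF assms(2)]]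
  by (intro M.add.finprod_mono_neutral_cong_left) (auto simp: fin_coeffs_def)

lemma indexed_lincomb_closed:
  assumes "c \<in> fin_coeffs R I" "g \<in> I \<rightarrow> carrier M"
  shows "indexed_lincomb R M g c \<in> carrier M"
  unfolding indexed_lincomb_def
  using assms fin_coeffs_supp[OF assms(1)] by (intro M.finsum_closed) (auto simp: fin_coeffs_def)

lemma indexed_lincomb_zero [simp]: "indexed_lincomb R M g (\<lambda>_. \<zero>) = \<zero>\<^bsub>M\<^esub>"
  by (simp add: indexed_lincomb_def)

lemma indexed_lincomb_single:
  assumes "g i \<in> carrier M" "a \<in> carrier R"
  shows "indexed_lincomb R M g (single R i a) = a \<odot>\<^bsub>M\<^esub> g i"
proof -
  have "indexed_lincomb R M g (single R i a) = finsum M (\<lambda>j. single R i a j \<odot>\<^bsub>M\<^esub> g j) {i}"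
    by (rule indexed_lincomb_superset[where I = "{i}"])
       (use assms in \<open>auto simp: single_def fin_coeffs_def\<close>)
  then show ?thesis using assms by (simp add: single_def)
qed

lemma indexed_lincomb_add:
  assumes c: "c \<in> fin_coeffs R I" and d: "d \<in> fin_coeffs R I" and g: "g \<in> I \<rightarrow> carrier M"
  shows "indexed_lincomb R M g (\<lambda>i. c i \<oplus> d i) =
    indexed_lincomb R M g c \<oplus>\<^bsub>M\<^esub> indexed_lincomb R M g d"
proof -
  let ?S = "{i. c i \<noteq> \<zero>} \<union> {i. d i \<noteq> \<zero>}"
  have S: "finite ?S" "?S \<subseteq> I" using c d by (auto simp: fin_coeffs_def)
  have cl: "\<And>i. c i \<in> carrier R" "\<And>i. d i \<in> carrier R" using c d by (auto simp: fin_coeffs_def)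
  have gi: "\<And>i. i \<in> ?S \<Longrightarrow> g i \<in> carrier M" using S g by auto
  have "indexed_lincomb R M g (\<lambda>i. c i \<oplus> d i) = finsum M (\<lambda>i. (c i \<oplus> d i) \<odot>\<^bsub>M\<^esub> g i) ?S"
    by (rule indexed_lincomb_superset[OF fin_coeffs_add[OF c d] g S(1)]) (use S in auto)
  also have "\<dots> = finsum M (\<lambda>i. c i \<odot>\<^bsub>M\<^esub> g i \<oplus>\<^bsub>M\<^esub> d i \<odot>\<^bsub>M\<^esub> g i) ?S"
    using cl gi by (intro M.add.finprod_cong') (auto simp: smult_l_distr)
  also have "\<dots> = finsum M (\<lambda>i. c i \<odot>\<^bsub>M\<^esub> g i) ?S \<oplus>\<^bsub>M\<^esub> finsum M (\<lambda>i. d i \<odot>\<^bsub>M\<^esub> g i) ?S"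
    using cl gi by (intro M.finsum_addf) auto
  also have "\<dots> = indexed_lincomb R M g c \<oplus>\<^bsub>M\<^esub> indexed_lincomb R M g d"
    using indexed_lincomb_superset[OF c g S(1) _ S(2)] indexed_lincomb_superset[OF d g S(1) _ S(2)]
    by simp
  finally show ?thesis .
qed

lemma indexed_lincomb_smult:
  assumes c: "c \<in> fin_coeffs R I" and a: "a \<in> carrier R" and g: "g \<in> I \<rightarrow> carrier M"
  shows "indexed_lincomb R M g (\<lambda>i. a \<otimes> c i) = a \<odot>\<^bsub>M\<^esub> indexed_lincomb R M g c"
proof -
  let ?S = "{i. c i \<noteq> \<zero>}"
  have S: "finite ?S" "?S \<subseteq> I" using c by (auto simp: fin_coeffs_def)
  have cl: "\<And>i. c i \<in> carrier R" using c by (auto simp: fin_coeffs_def)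
  have gi: "\<And>i. i \<in> ?S \<Longrightarrow> g i \<in> carrier M" using S g by auto
  have "indexed_lincomb R M g (\<lambda>i. a \<otimes> c i) = finsum M (\<lambda>i. (a \<otimes> c i) \<odot>\<^bsub>M\<^esub> g i) ?S"
    by (rule indexed_lincomb_superset[OF fin_coeffs_smult[OF c a] g S(1)]) (use S a in auto)
  also have "\<dots> = finsum M (\<lambda>i. a \<odot>\<^bsub>M\<^esub> (c i \<odot>\<^bsub>M\<^esub> g i)) ?S"
    using cl gi a by (intro M.add.finprod_cong') (auto simp: smult_assoc1)
  also have "\<dots> = a \<odot>\<^bsub>M\<^esub> finsum M (\<lambda>i. c i \<odot>\<^bsub>M\<^esub> g i) ?S"
    using cl gi a S by (intro finsum_smult_ldistr[symmetric]) auto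
  finally show ?thesis by (simp add: indexed_lincomb_def)
qed

text \<open>Negation is multiplication by minus one, so closure under scalars already yields the
  inverses that a subgroup requires.\<close>

lemma submoduleI_smult:
  assumes "H \<subseteq> carrier M" "\<zero>\<^bsub>M\<^esub> \<in> H"
    and "\<And>x y. x \<in> H \<Longrightarrow> y \<in> H \<Longrightarrow> x \<oplus>\<^bsub>M\<^esub> y \<in> H"
    and smult: "\<And>a x. a \<in> carrier R \<Longrightarrow> x \<in> H \<Longrightarrow> a \<odot>\<^bsub>M\<^esub> x \<in> H"
  shows "submodule H R M"
proof (rule submoduleI)
  show "\<ominus>\<^bsub>M\<^esub> x \<in> H" if "x \<in> H" for x
    using smult[of "\<ominus> \<one>" x] that assms(1) smult_l_minus[of \<one> x] by (auto simp: subset_iff)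
qed (use assms in auto)

lemma submodule_zero: "submodule H R M \<Longrightarrow> \<zero>\<^bsub>M\<^esub> \<in> H"
  by (auto dest!: submodule.axioms(1) subgroup.one_closed)

end

section \<open>Linear maps\<close>

text \<open>A sum over an infinite index set is zero by convention, so preservation of zero covers
  that case together with the empty one.\<close>

lemma additive_finsum:
  assumes "abelian_monoid V" "abelian_monoid W"
    and "\<And>x. x \<in> carrier V \<Longrightarrow> \<phi> x \<in> carrier W"
    and "\<And>x y. x \<in> carrier V \<Longrightarrow> y \<in> carrier V \<Longrightarrow> \<phi> (x \<oplus>\<^bsub>V\<^esub> y) = \<phi> x \<oplus>\<^bsub>W\<^esub> \<phi> y"
    and "\<phi> \<zero>\<^bsub>V\<^esub> = \<zero>\<^bsub>W\<^esub>" and "g \<in> S \<rightarrow> carrier V"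
  shows "\<phi> (finsum V g S) = finsum W (\<lambda>i. \<phi> (g i)) S"
proof -
  interpret V: abelian_monoid V by fact
  interpret W: abelian_monoid W by fact
  show ?thesis using assms(6)
  proof (induction S rule: infinite_finite_induct)
    case (insert s S)
    then have "(\<lambda>i. \<phi> (g i)) \<in> S \<rightarrow> carrier W" "\<phi> (g s) \<in> carrier W" "g \<in> S \<rightarrow> carrier V" "g s \<in> carrier V"
      using assms(3) by auto
    with insert show ?case by (simp add: assms(4))
  qed (auto simp: assms(5))
qed

lemma lin_mapsD:
  assumes "\<phi> \<in> lin_maps F V W"
  shows "x \<in> carrier V \<Longrightarrow> \<phi> x \<in> carrier W"
    and "x \<in> carrier V \<Longrightarrow> y \<in> carrier V \<Longrightarrow> \<phi> (x \<oplus>\<^bsub>V\<^esub> y) = \<phi> x \<oplus>\<^bsub>W\<^esub> \<phi> y"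
    and "a \<in> carrier F \<Longrightarrow> x \<in> carrier V \<Longrightarrow> \<phi> (a \<odot>\<^bsub>V\<^esub> x) = a \<odot>\<^bsub>W\<^esub> \<phi> x"
    and "\<phi> \<in> extensional (carrier V)"
  using assms by (auto simp: lin_maps_def PiE_def)

lemma lin_maps_restrictI:
  assumes "module F V"
    and "\<And>x. x \<in> carrier V \<Longrightarrow> \<phi> x \<in> carrier W"
    and "\<And>x y. x \<in> carrier V \<Longrightarrow> y \<in> carrier V \<Longrightarrow> \<phi> (x \<oplus>\<^bsub>V\<^esub> y) = \<phi> x \<oplus>\<^bsub>W\<^esub> \<phi> y"
    and "\<And>a x. a \<in> carrier F \<Longrightarrow> x \<in> carrier V \<Longrightarrow> \<phi> (a \<odot>\<^bsub>V\<^esub> x) = a \<odot>\<^bsub>W\<^esub> \<phi> x"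
  shows "restrict \<phi> (carrier V) \<in> lin_maps F V W"
proof -
  interpret V: module F V by fact
  show ?thesis using assms by (auto simp: lin_maps_def)
qed

text \<open>Preservation of zero is not a clause of \<open>lin_maps\<close>; it follows by writing
  the zero vector as a multiple with scalar zero.\<close>

lemma lin_maps_zero:
  assumes "module F V" "module F W" "\<phi> \<in> lin_maps F V W"
  shows "\<phi> \<zero>\<^bsub>V\<^esub> = \<zero>\<^bsub>W\<^esub>"
proof -
  interpret V: module F V by fact
  interpret W: module F W by fact
  have "\<phi> \<zero>\<^bsub>V\<^esub> = \<phi> (\<zero>\<^bsub>F\<^esub> \<odot>\<^bsub>V\<^esub> \<zero>\<^bsub>V\<^esub>)" by simp
  also have "\<dots> = \<zero>\<^bsub>F\<^esub> \<odot>\<^bsub>W\<^esub> \<phi> \<zero>\<^bsub>V\<^esub>"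
    by (rule lin_mapsD(3)[OF assms(3)]) auto
  also have "\<dots> = \<zero>\<^bsub>W\<^esub>"
    using lin_mapsD(1)[OF assms(3)] by simp
  finally show ?thesis .
qed

lemma lin_maps_indexed_lincomb:
  assumes V: "module F V" and W: "module F W" and \<phi>: "\<phi> \<in> lin_maps F V W"
    and c: "c \<in> fin_coeffs F I" and g: "g \<in> I \<rightarrow> carrier V"
  shows "\<phi> (indexed_lincomb F V g c) = indexed_lincomb F W (\<lambda>i. \<phi> (g i)) c"
proof -
  interpret V: module F V by fact
  interpret W: module F W by fact
  note L = lin_mapsD[OF \<phi>]
  have g': "(\<lambda>i. \<phi> (g i)) \<in> I \<rightarrow> carrier W" using g L by auto
  show ?thesis using c
  proof (induction c rule: V.fin_coeffs_induct)
    case zero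
    then show ?case by (simp add: lin_maps_zero[OF V W \<phi>])
  next
    case (single i a)
    then have "g i \<in> carrier V" using g by auto
    then show ?case using single L by (simp add: V.indexed_lincomb_single W.indexed_lincomb_single)
  next
    case (add c d)
    then show ?case using g g' L
      by (simp add: V.indexed_lincomb_add[where I=I] W.indexed_lincomb_add[where I=I]
          V.indexed_lincomb_closed[where I=I])
  qed
qed

lemma lin_maps_compose:
  assumes "module F U" "\<phi> \<in> lin_maps F U V" "\<psi> \<in> lin_maps F V W"
  shows "compose (carrier U) \<psi> \<phi> \<in> lin_maps F U W"
  unfolding compose_def
  by (rule lin_maps_restrictI) (use assms lin_mapsD[OF assms(2)] lin_mapsD[OF assms(3)] in auto)

section \<open>Existence of bases\<close>

text \<open>The independence clause of \<open>is_basis\<close>, separated from spanning so that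
  Zorn's lemma can be applied to it.\<close>

definition lin_indep :: "('f, 'r) ring_scheme \<Rightarrow> ('f, 'u, 'v) module_scheme \<Rightarrow> 'u set \<Rightarrow> bool" where
  "lin_indep F V Y \<longleftrightarrow>
     (\<forall>c\<in>fin_coeffs F Y. lincomb F V c = \<zero>\<^bsub>V\<^esub> \<longrightarrow> (\<forall>y\<in>Y. c y = \<zero>\<^bsub>F\<^esub>))"

text \<open>A relation has finite support, and a finite subset of the union of a nonempty chain lies
  in a single member. There the relation is trivial, and outside that member its coefficients vanish
  anyway.\<close>

lemma lin_indep_Union_chain:
  assumes "subset.chain A C" "\<And>Y. Y \<in> C \<Longrightarrow> lin_indep F V Y" "C \<noteq> {}"
  shows "lin_indep F V (\<Union>C)"
  unfolding lin_indep_def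
proof (intro ballI impI)
  fix c y assume c: "c \<in> fin_coeffs F (\<Union>C)" and z: "lincomb F V c = \<zero>\<^bsub>V\<^esub>" and y: "y \<in> \<Union>C"
  let ?S = "{y. c y \<noteq> \<zero>\<^bsub>F\<^esub>}"
  have S: "finite ?S" "?S \<subseteq> \<Union>C" using c by (auto simp: fin_coeffs_def)
  obtain Y where Y: "Y \<in> C" "?S \<subseteq> Y"
    using finite_subset_Union_chain[OF S assms(3)] assms(1) by blast
  then have "c \<in> fin_coeffs F Y" using c by (auto simp: fin_coeffs_def)
  then have "\<forall>y\<in>Y. c y = \<zero>\<^bsub>F\<^esub>" using assms(2)[OF Y(1)] z by (auto simp: lin_indep_def)
  with Y show "c y = \<zero>\<^bsub>F\<^esub>" by auto
qed

text \<open>A relation with nonzero coefficient at \<open>w\<close> could be solved for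
  \<open>w\<close>, contradicting \<open>notin\<close>. So that coefficient vanishes and the
  relation lives on \<open>Y\<close>.\<close>

lemma lin_indep_insert:
  assumes "field F" "module F V" and Y: "lin_indep F V Y" "Y \<subseteq> carrier V" and w: "w \<in> carrier V"
    and notin: "\<And>c. c \<in> fin_coeffs F Y \<Longrightarrow> w \<noteq> lincomb F V c"
  shows "lin_indep F V (insert w Y)"
  unfolding lin_indep_def
proof (rule ballI, rule impI)
  interpret F: field F by fact
  interpret V: module F V by fact
  fix c assume c: "c \<in> fin_coeffs F (insert w Y)" and z: "lincomb F V c = \<zero>\<^bsub>V\<^esub>"
  let ?d = "c(w := \<zero>\<^bsub>F\<^esub>)"
  have "finite {i. ?d i \<noteq> \<zero>\<^bsub>F\<^esub>}"
    by (rule finite_subset[of _ "{i. c i \<noteq> \<zero>\<^bsub>F\<^esub>}"]) (use c in \<open>auto simp: fin_coeffs_def\<close>)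
  then have d: "?d \<in> fin_coeffs F Y" using c by (auto simp: fin_coeffs_def)
  have cw: "c w \<in> carrier F" using c by (auto simp: fin_coeffs_def)
  have idY: "(\<lambda>y. y) \<in> Y \<rightarrow> carrier V" and idwY: "(\<lambda>y. y) \<in> insert w Y \<rightarrow> carrier V"
    using Y(2) w by auto
  have dcl: "lincomb F V ?d \<in> carrier V"
    using V.indexed_lincomb_closed[OF d idY] by (simp add: lincomb_eq_indexed)
  have "c = (\<lambda>i. single F w (c w) i \<oplus>\<^bsub>F\<^esub> ?d i)"
    using c by (auto simp: single_def fin_coeffs_def fun_eq_iff)
  then have "lincomb F V c = lincomb F V (\<lambda>i. single F w (c w) i \<oplus>\<^bsub>F\<^esub> ?d i)" by simp
  also have "\<dots> = c w \<odot>\<^bsub>V\<^esub> w \<oplus>\<^bsub>V\<^esub> lincomb F V ?d"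
    unfolding lincomb_eq_indexed
    using V.indexed_lincomb_add[OF F.fin_coeffs_single[OF insertI1 cw] fin_coeffs_mono[OF d subset_insertI] idwY]
      V.indexed_lincomb_single[of "\<lambda>y. y" w] w cw by simp
  finally have eq: "c w \<odot>\<^bsub>V\<^esub> w \<oplus>\<^bsub>V\<^esub> lincomb F V ?d = \<zero>\<^bsub>V\<^esub>" using z by simp
  have cw0: "c w = \<zero>\<^bsub>F\<^esub>"
  proof (rule ccontr)
    assume "c w \<noteq> \<zero>\<^bsub>F\<^esub>"
    then have u: "c w \<in> Units F" using cw by (simp add: F.field_Units)
    let ?b = "inv\<^bsub>F\<^esub> (c w)"
    have b: "?b \<in> carrier F" "?b \<otimes>\<^bsub>F\<^esub> c w = \<one>\<^bsub>F\<^esub>" using u by auto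
    \<comment> \<open>The sign is turned into a scalar so that, after division by
      \<open>c w\<close>, the right-hand side is again one linear combination over
      \<open>Y\<close>.\<close>
    have "c w \<odot>\<^bsub>V\<^esub> w = \<ominus>\<^bsub>V\<^esub> lincomb F V ?d"
      using eq dcl w cw by (metis V.M.minus_equality V.smult_closed)
    also have "\<dots> = \<ominus>\<^bsub>F\<^esub> \<one>\<^bsub>F\<^esub> \<odot>\<^bsub>V\<^esub> lincomb F V ?d"
      using dcl by (simp add: V.smult_l_minus)
    finally have "?b \<odot>\<^bsub>V\<^esub> (c w \<odot>\<^bsub>V\<^esub> w) = ?b \<odot>\<^bsub>V\<^esub> (\<ominus>\<^bsub>F\<^esub> \<one>\<^bsub>F\<^esub> \<odot>\<^bsub>V\<^esub> lincomb F V ?d)" by simp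
    then have "w = (?b \<otimes>\<^bsub>F\<^esub> \<ominus>\<^bsub>F\<^esub> \<one>\<^bsub>F\<^esub>) \<odot>\<^bsub>V\<^esub> lincomb F V ?d"
      using b w cw dcl V.smult_assoc1[of ?b "c w" w] V.smult_assoc1[of ?b "\<ominus>\<^bsub>F\<^esub> \<one>\<^bsub>F\<^esub>" "lincomb F V ?d"]
      by simp
    also have "\<dots> = lincomb F V (\<lambda>i. (?b \<otimes>\<^bsub>F\<^esub> \<ominus>\<^bsub>F\<^esub> \<one>\<^bsub>F\<^esub>) \<otimes>\<^bsub>F\<^esub> ?d i)"
      unfolding lincomb_eq_indexed
      using V.indexed_lincomb_smult[OF d _ idY, of "?b \<otimes>\<^bsub>F\<^esub> \<ominus>\<^bsub>F\<^esub> \<one>\<^bsub>F\<^esub>"] b(1) by simp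
    finally show False
      using notin[OF F.fin_coeffs_smult[OF d, of "?b \<otimes>\<^bsub>F\<^esub> \<ominus>\<^bsub>F\<^esub> \<one>\<^bsub>F\<^esub>"]] b(1) by simp
  qed
  then have "?d = c" by auto
  then have "\<forall>y\<in>Y. c y = \<zero>\<^bsub>F\<^esub>" using Y(1) d z by (auto simp: lin_indep_def)
  then show "\<forall>y\<in>insert w Y. c y = \<zero>\<^bsub>F\<^esub>" using cw0 by simp
qed

text \<open>Zorn's lemma among the independent subsets of \<open>W\<close>; a maximal one spans, as
  otherwise a vector outside its span could be adjoined.\<close>

lemma basis_exists:
  assumes F: "field F" and V: "module F V" and W: "submodule W F V"
  shows "\<exists>Y. is_basis F V W Y"
proof -
  interpret F: field F by fact
  interpret V: module F V by fact
  have WV: "W \<subseteq> carrier V" by (rule V.submoduleE(1)[OF W])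
  let ?A = "{Y. Y \<subseteq> W \<and> lin_indep F V Y}"
  have ne: "?A \<noteq> {}" by (auto simp: lin_indep_def intro!: exI[of _ "{}"])
  have ch: "\<Union>C \<in> ?A" if "C \<noteq> {}" "subset.chain ?A C" for C
    using lin_indep_Union_chain[OF that(2) _ that(1)] that(2) by (auto simp: subset.chain_def)
  obtain Y where Y: "Y \<in> ?A" and max: "\<And>X. X \<in> ?A \<Longrightarrow> Y \<subseteq> X \<Longrightarrow> X = Y"
    using subset_Zorn_nonempty[OF ne] ch by (metis (no_types, lifting))
  have "\<exists>c\<in>fin_coeffs F Y. w = lincomb F V c" if w: "w \<in> W" for w
  proof (rule ccontr)
    assume no: "\<not> ?thesis"
    then have "lin_indep F V (insert w Y)"
      using Y WV w by (intro lin_indep_insert[OF F V]) auto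
    \<comment> \<open>Maximality puts \<open>w\<close> into \<open>Y\<close>, but then
      \<open>w\<close> is its own one-term combination, contrary to the choice of
      \<open>w\<close>.\<close>
    then have "w \<in> Y" using max[of "insert w Y"] Y w by auto
    then have "w = lincomb F V (single F w \<one>\<^bsub>F\<^esub>)"
      unfolding lincomb_eq_indexed
      using V.indexed_lincomb_single[of "\<lambda>y. y" w "\<one>\<^bsub>F\<^esub>"] WV w by auto
    with no F.fin_coeffs_single[OF \<open>w \<in> Y\<close>, of "\<one>\<^bsub>F\<^esub>"] show False by blast
  qed
  then show ?thesis using Y by (auto simp: is_basis_def lin_indep_def)
qed

section \<open>Sums of homogeneous families\<close>

lemma grade_families_closed:
  assumes "module F V" "\<And>t. t \<in> T \<Longrightarrow> submodule (grade V t) F V" "x \<in> grade_families T V"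
  shows "x t \<in> carrier V"
proof -
  interpret V: module F V by fact
  show ?thesis
  proof (cases "t \<in> T")
    case True
    then show ?thesis using assms(3) V.submoduleE(1)[OF assms(2)] by (auto simp: grade_families_def)
  qed (use assms(3) in \<open>auto simp: grade_families_def\<close>)
qed

lemma family_sum_superset:
  assumes "module F V" "\<And>t. x t \<in> carrier V" "finite S" "{t. x t \<noteq> \<zero>\<^bsub>V\<^esub>} \<subseteq> S"
  shows "family_sum V x = finsum V x S"
proof -
  interpret V: module F V by fact
  show ?thesis unfolding family_sum_def
    using assms by (intro V.M.add.finprod_mono_neutral_cong_left) auto
qed

lemma family_sum_single:
  assumes "module F V" "v \<in> carrier V"
  shows "family_sum V (\<lambda>s. if s = t then v else \<zero>\<^bsub>V\<^esub>) = v"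
proof -
  interpret V: module F V by fact
  have "family_sum V (\<lambda>s. if s = t then v else \<zero>\<^bsub>V\<^esub>) = finsum V (\<lambda>s. if s = t then v else \<zero>\<^bsub>V\<^esub>) {t}"
    by (rule family_sum_superset[OF assms(1)]) (use assms in auto)
  then show ?thesis using assms by simp
qed

lemma family_sum_zero: "module F V \<Longrightarrow> family_sum V (\<lambda>_. \<zero>\<^bsub>V\<^esub>) = \<zero>\<^bsub>V\<^esub>"
  using family_sum_single[of F V "\<zero>\<^bsub>V\<^esub>"] abelian_monoid.zero_closed[of V]
  by (simp add: module_def abelian_group_def)

section \<open>The sum of a family of submodules\<close>

context
  fixes F :: "('f, 'r) ring_scheme" and T :: "'t set" and V :: "('f, 'u, 't, 'v) graded_module_scheme"
  assumes V: "module F V" and sub: "\<And>t. t \<in> T \<Longrightarrow> submodule (grade V t) F V"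
begin

interpretation V: module F V by (fact V)

lemma grade_families_zero: "(\<lambda>_. \<zero>\<^bsub>V\<^esub>) \<in> grade_families T V"
  using V.submodule_zero[OF sub] by (auto simp: grade_families_def)

lemma grade_families_single:
  "t \<in> T \<Longrightarrow> v \<in> grade V t \<Longrightarrow> (\<lambda>s. if s = t then v else \<zero>\<^bsub>V\<^esub>) \<in> grade_families T V"
  using V.submodule_zero[OF sub] by (auto simp: grade_families_def)

lemma grade_families_add:
  assumes x: "x \<in> grade_families T V" and y: "y \<in> grade_families T V"
  shows "(\<lambda>t. x t \<oplus>\<^bsub>V\<^esub> y t) \<in> grade_families T V"
    and "family_sum V (\<lambda>t. x t \<oplus>\<^bsub>V\<^esub> y t) = family_sum V x \<oplus>\<^bsub>V\<^esub> family_sum V y"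
proof -
  note cl = grade_families_closed[OF V sub x] grade_families_closed[OF V sub y]
  let ?S = "{t. x t \<noteq> \<zero>\<^bsub>V\<^esub>} \<union> {t. y t \<noteq> \<zero>\<^bsub>V\<^esub>}"
  have S: "finite ?S" "{t. x t \<oplus>\<^bsub>V\<^esub> y t \<noteq> \<zero>\<^bsub>V\<^esub>} \<subseteq> ?S" using x y by (auto simp: grade_families_def)
  show "(\<lambda>t. x t \<oplus>\<^bsub>V\<^esub> y t) \<in> grade_families T V"
    using x y V.submoduleE(5)[OF sub] finite_subset[OF S(2,1)] by (auto simp: grade_families_def)
  have "family_sum V (\<lambda>t. x t \<oplus>\<^bsub>V\<^esub> y t) = finsum V (\<lambda>t. x t \<oplus>\<^bsub>V\<^esub> y t) ?S"
    by (rule family_sum_superset[OF V _ S]) (use cl in auto)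
  also have "\<dots> = finsum V x ?S \<oplus>\<^bsub>V\<^esub> finsum V y ?S"
    using cl by (intro V.M.finsum_addf) auto
  also have "\<dots> = family_sum V x \<oplus>\<^bsub>V\<^esub> family_sum V y"
    using family_sum_superset[OF V cl(1) S(1)] family_sum_superset[OF V cl(2) S(1)] by simp
  finally show "family_sum V (\<lambda>t. x t \<oplus>\<^bsub>V\<^esub> y t) = family_sum V x \<oplus>\<^bsub>V\<^esub> family_sum V y" .
qed

text \<open>The image family may have smaller support, so both sums are taken over the support of
  \<open>x\<close>. Besides homomorphisms, this is applied to the inclusion of \<open>U A\<close>
  into \<open>A\<close>, to compare sums formed in two different structures.\<close>

lemma lin_maps_family_sum:
  assumes W: "module F W" and \<phi>: "\<phi> \<in> lin_maps F V W" and x: "x \<in> grade_families T V"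
  shows "\<phi> (family_sum V x) = family_sum W (\<lambda>t. \<phi> (x t))"
proof -
  interpret W: module F W by (fact W)
  note cl = grade_families_closed[OF V sub x]
  note L = lin_mapsD[OF \<phi>]
  have "\<phi> (family_sum V x) = finsum W (\<lambda>t. \<phi> (x t)) {t. x t \<noteq> \<zero>\<^bsub>V\<^esub>}"
    unfolding family_sum_def
    by (rule additive_finsum[where V=V])
       (use L cl lin_maps_zero[OF V W \<phi>] V.M.abelian_monoid_axioms W.M.abelian_monoid_axioms in auto)
  also have "\<dots> = family_sum W (\<lambda>t. \<phi> (x t))"
    by (rule family_sum_superset[OF W, symmetric])
       (use L cl x lin_maps_zero[OF V W \<phi>] in \<open>auto simp: grade_families_def\<close>)
  finally show ?thesis .
qed

lemma grade_families_smult: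
  assumes a: "a \<in> carrier F" and x: "x \<in> grade_families T V"
  shows "(\<lambda>t. a \<odot>\<^bsub>V\<^esub> x t) \<in> grade_families T V"
    and "family_sum V (\<lambda>t. a \<odot>\<^bsub>V\<^esub> x t) = a \<odot>\<^bsub>V\<^esub> family_sum V x"
proof -
  note cl = grade_families_closed[OF V sub x]
  have S: "finite {t. x t \<noteq> \<zero>\<^bsub>V\<^esub>}" "{t. a \<odot>\<^bsub>V\<^esub> x t \<noteq> \<zero>\<^bsub>V\<^esub>} \<subseteq> {t. x t \<noteq> \<zero>\<^bsub>V\<^esub>}"
    using x a by (auto simp: grade_families_def)
  show "(\<lambda>t. a \<odot>\<^bsub>V\<^esub> x t) \<in> grade_families T V"
    using x a V.submoduleE(4)[OF sub] finite_subset[OF S(2,1)] by (auto simp: grade_families_def)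
  have "family_sum V (\<lambda>t. a \<odot>\<^bsub>V\<^esub> x t) = finsum V (\<lambda>t. a \<odot>\<^bsub>V\<^esub> x t) {t. x t \<noteq> \<zero>\<^bsub>V\<^esub>}"
    by (rule family_sum_superset[OF V _ S]) (use cl a in auto)
  then show "family_sum V (\<lambda>t. a \<odot>\<^bsub>V\<^esub> x t) = a \<odot>\<^bsub>V\<^esub> family_sum V x"
    using V.finsum_smult_ldistr[OF S(1) a, of x] cl by (auto simp: family_sum_def)
qed

text \<open>Applied with \<open>H\<close> the whole space, and with \<open>H\<close> the span of a
  homogeneous basis, where it yields the spanning property.\<close>

lemma grade_total_least:
  assumes H: "submodule H F V" "\<And>t. t \<in> T \<Longrightarrow> grade V t \<subseteq> H"
  shows "grade_total T V \<subseteq> H"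
proof -
  have HV: "H \<subseteq> carrier V" by (rule V.submoduleE(1)[OF H(1)])
  have "finsum V x S \<in> H" if "x \<in> S \<rightarrow> H" for x :: "'t \<Rightarrow> 'u" and S
    using that
  proof (induction S rule: infinite_finite_induct)
    case (insert s S)
    then have "x \<in> S \<rightarrow> carrier V" "x s \<in> carrier V" using HV by auto
    with insert show ?case using V.submoduleE(5)[OF H(1)] by auto
  qed (use V.submodule_zero[OF H(1)] in auto)
  moreover have "x t \<in> H" if "x \<in> grade_families T V" for x t
    using that H(2) V.submodule_zero[OF H(1)] by (cases "t \<in> T") (auto simp: grade_families_def)
  ultimately show ?thesis by (auto simp: grade_total_def family_sum_def)
qed

lemma grade_subset_total: "t \<in> T \<Longrightarrow> grade V t \<subseteq> grade_total T V"
proof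
  fix v assume t: "t \<in> T" and v: "v \<in> grade V t"
  then have "v \<in> carrier V" using V.submoduleE(1)[OF sub] by auto
  then show "v \<in> grade_total T V"
    using family_sum_single[OF V, of v t] grade_families_single[OF t v]
    unfolding grade_total_def by (metis (no_types, lifting) imageI)
qed

lemma submodule_grade_total: "submodule (grade_total T V) F V"
proof (rule V.submoduleI_smult)
  show "grade_total T V \<subseteq> carrier V"
    by (rule grade_total_least[OF V.carrier_is_submodule]) (use V.submoduleE(1)[OF sub] in auto)
  show "\<zero>\<^bsub>V\<^esub> \<in> grade_total T V"
    using family_sum_zero[OF V] grade_families_zero unfolding grade_total_def
    by (metis (no_types, lifting) imageI)
  show "x \<oplus>\<^bsub>V\<^esub> y \<in> grade_total T V" if "x \<in> grade_total T V" "y \<in> grade_total T V" for x y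
    using that grade_families_add unfolding grade_total_def
    by (auto simp: image_iff) (metis (no_types, lifting))
  show "a \<odot>\<^bsub>V\<^esub> x \<in> grade_total T V" if "a \<in> carrier F" "x \<in> grade_total T V" for a x
    using that grade_families_smult[OF that(1)] unfolding grade_total_def
    by (auto simp: image_iff) (metis (no_types, lifting))
qed

text \<open>Applying the map to each component of a decomposition gives a homogeneous decomposition
  of the image. This is why homomorphisms restrict to the distinguished subspaces.\<close>

lemma lin_maps_grade_total:
  assumes W: "module F W" and \<phi>: "\<phi> \<in> lin_maps F V W" and g: "grade_preserving T V W \<phi>"
    and v: "v \<in> grade_total T V"
  shows "\<phi> v \<in> grade_total T W"
proof -
  obtain x where x: "x \<in> grade_families T V" and vx: "v = family_sum V x"
    using v by (auto simp: grade_total_def)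
  have "{t. \<phi> (x t) \<noteq> \<zero>\<^bsub>W\<^esub>} \<subseteq> {t. x t \<noteq> \<zero>\<^bsub>V\<^esub>}" using lin_maps_zero[OF V W \<phi>] by auto
  then have "(\<lambda>t. \<phi> (x t)) \<in> grade_families T W"
    using x g lin_maps_zero[OF V W \<phi>]
    by (auto simp: grade_families_def grade_preserving_def image_subset_iff intro: finite_subset)
  then show ?thesis using lin_maps_family_sum[OF W \<phi> x] vx by (auto simp: grade_total_def)
qed

end

text \<open>Homogeneous families in \<open>W\<close> lift along the injective \<open>\<phi>\<close>
  to homogeneous families in \<open>V\<close>, so equality of sums can be tested in
  \<open>V\<close>. It is meant for \<open>KV\<close>, whose components are the copies of those of
  \<open>V\<close> in degree 1.\<close>

lemma direct_grading_image:
  assumes V: "module F V" and W: "module F W" and \<phi>: "\<phi> \<in> lin_maps F V W"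
    and inj: "inj_on \<phi> (carrier V)" and dir: "direct_grading F T V"
    and grW: "\<And>t. t \<in> T \<Longrightarrow> grade W t = \<phi> ` grade V t"
  shows "direct_grading F T W"
proof -
  interpret V: module F V by (fact V)
  interpret W: module F W by (fact W)
  note L = lin_mapsD[OF \<phi>] and z = lin_maps_zero[OF V W \<phi>]
  have sub: "\<And>t. t \<in> T \<Longrightarrow> submodule (grade V t) F V" using dir by (auto simp: direct_grading_def)
  have gV: "v \<in> carrier V" if "t \<in> T" "v \<in> grade V t" for t v using V.submoduleE(1)[OF sub] that by auto
  have "submodule (grade W t) F W" if t: "t \<in> T" for t
  proof (rule W.submoduleI_smult)
    note E = V.submoduleE[OF sub[OF t]] V.submodule_zero[OF sub[OF t]]
    show "grade W t \<subseteq> carrier W" using L gV t by (auto simp: grW)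
    show "\<zero>\<^bsub>W\<^esub> \<in> grade W t" using E z by (force simp: grW t)
    show "x \<oplus>\<^bsub>W\<^esub> y \<in> grade W t" if xy: "x \<in> grade W t" "y \<in> grade W t" for x y
    proof -
      obtain u v where "x = \<phi> u" "y = \<phi> v" "u \<in> grade V t" "v \<in> grade V t" using xy by (auto simp: grW t)
      then show ?thesis using L(2)[of u v] gV[OF t] E(5)[of u v] unfolding grW[OF t] by (metis imageI)
    qed
    show "a \<odot>\<^bsub>W\<^esub> x \<in> grade W t" if ax: "a \<in> carrier F" "x \<in> grade W t" for a x
    proof -
      obtain u where "x = \<phi> u" "u \<in> grade V t" using ax by (auto simp: grW t)
      then show ?thesis using L(3)[of a u] gV[OF t] E(4)[of a u] ax(1) unfolding grW[OF t] by (metis imageI)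
    qed
  qed
  moreover have "inj_on (family_sum W) (grade_families T W)"
  proof -
    have pre: "\<exists>x\<in>grade_families T V. x' = (\<lambda>t. \<phi> (x t))" if x': "x' \<in> grade_families T W" for x'
    proof -
      \<comment> \<open>Outside \<open>T\<close> the preimage is prescribed to be zero, as
        \<open>grade_families\<close> demands of the lifted family.\<close>
      have "\<forall>t. \<exists>v. (t \<in> T \<longrightarrow> v \<in> grade V t) \<and> (t \<notin> T \<longrightarrow> v = \<zero>\<^bsub>V\<^esub>) \<and> x' t = \<phi> v"
      proof
        fix t
        show "\<exists>v. (t \<in> T \<longrightarrow> v \<in> grade V t) \<and> (t \<notin> T \<longrightarrow> v = \<zero>\<^bsub>V\<^esub>) \<and> x' t = \<phi> v"
          using x' grW[of t] z by (cases "t \<in> T") (auto simp: grade_families_def)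
      qed
      then obtain x where x: "\<And>t. t \<in> T \<Longrightarrow> x t \<in> grade V t" "\<And>t. t \<notin> T \<Longrightarrow> x t = \<zero>\<^bsub>V\<^esub>" "\<And>t. x' t = \<phi> (x t)"
        by metis
      have "x t \<in> carrier V" for t using x(1,2)[of t] gV by (cases "t \<in> T") auto
      \<comment> \<open>Injectivity is what keeps the lifted family finitely supported: only zero is
        sent to zero.\<close>
      then have "{t. x t \<noteq> \<zero>\<^bsub>V\<^esub>} \<subseteq> {t. x' t \<noteq> \<zero>\<^bsub>W\<^esub>}"
        using x(3) z inj by (auto simp: inj_on_def)
      then have "x \<in> grade_families T V" using x x' by (auto simp: grade_families_def intro: finite_subset)
      with x(3) show ?thesis by auto
    qed
    show ?thesis
    proof (rule inj_onI)
      fix x' y' assume x': "x' \<in> grade_families T W" and y': "y' \<in> grade_families T W"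
        and eq: "family_sum W x' = family_sum W y'"
      obtain x where x: "x \<in> grade_families T V" "x' = (\<lambda>t. \<phi> (x t))" using pre[OF x'] by auto
      obtain y where y: "y \<in> grade_families T V" "y' = (\<lambda>t. \<phi> (y t))" using pre[OF y'] by auto
      have tot: "family_sum V u \<in> carrier V" if "u \<in> grade_families T V" for u
        using V.submoduleE(1)[OF submodule_grade_total[OF V sub]] that by (auto simp: grade_total_def)
      have "\<phi> (family_sum V x) = \<phi> (family_sum V y)"
        using eq x y lin_maps_family_sum[OF V sub W \<phi>] by simp
      then have "family_sum V x = family_sum V y" using inj tot x y by (auto simp: inj_on_def)
      then have "x = y" using dir x y by (auto simp: direct_grading_def inj_on_def)
      then show "x' = y'" using x y by simp
    qed
  qed
  ultimately show ?thesis by (auto simp: direct_grading_def)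
qed

section \<open>Homogeneous bases\<close>

text \<open>In a field one differs from zero, so a zero basis vector would give a nontrivial
  relation. Together with the next lemma this makes the chosen bases of different components
  disjoint.\<close>

lemma is_basis_nonzero:
  assumes "field F" "module F V" "is_basis F V W Y" "y \<in> Y"
  shows "y \<noteq> \<zero>\<^bsub>V\<^esub>"
proof
  interpret F: field F by fact
  interpret V: module F V by fact
  assume "y = \<zero>\<^bsub>V\<^esub>"
  then have "lincomb F V (single F y \<one>\<^bsub>F\<^esub>) = \<zero>\<^bsub>V\<^esub>"
    unfolding lincomb_eq_indexed by (simp add: V.indexed_lincomb_single)
  then have "single F y \<one>\<^bsub>F\<^esub> y = \<zero>\<^bsub>F\<^esub>"
    using assms(3,4) F.fin_coeffs_single[OF assms(4), of "\<one>\<^bsub>F\<^esub>"] unfolding is_basis_def by blast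
  then show False by (simp add: single_def)
qed

text \<open>The families concentrated at \<open>s\<close> and at \<open>t\<close> with value
  \<open>v\<close> have the same sum, so directness identifies them.\<close>

lemma direct_grading_inter:
  assumes V: "module F V" and dir: "direct_grading F T V"
    and st: "s \<in> T" "t \<in> T" "s \<noteq> t" and v: "v \<in> grade V s" "v \<in> grade V t"
  shows "v = \<zero>\<^bsub>V\<^esub>"
proof -
  interpret V: module F V by (fact V)
  have sub: "\<And>t. t \<in> T \<Longrightarrow> submodule (grade V t) F V" using dir by (auto simp: direct_grading_def)
  have vV: "v \<in> carrier V" using V.submoduleE(1)[OF sub[OF st(1)]] v by auto
  have "(\<lambda>r. if r = s then v else \<zero>\<^bsub>V\<^esub>) = (\<lambda>r. if r = t then v else \<zero>\<^bsub>V\<^esub>)"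
    using dir grade_families_single[OF V sub] st v family_sum_single[OF V vV]
    by (auto simp: direct_grading_def inj_on_def)
  then show ?thesis using st(3) by (metis (full_types))
qed

text \<open>Independence: grouping the coefficients by component turns a relation into a homogeneous
  family with sum zero. Directness kills each member of the family, and the basis of each component
  then kills the coefficients. Spanning: the span is a submodule containing every component.\<close>

lemma hom_basis_is_basis:
  assumes F: "field F" and gs: "graded_space F T V"
  shows "is_basis F V (carrier V) (hom_basis F T V)"
proof -
  have V: "module F V" and dir: "direct_grading F T V" and tot: "grade_total T V = carrier V"
    using gs by (auto simp: graded_space_def)
  interpret F: field F by fact
  interpret V: module F V by fact
  have sub: "\<And>t. t \<in> T \<Longrightarrow> submodule (grade V t) F V" using dir by (auto simp: direct_grading_def)
  define B where "B = (\<lambda>t. SOME Y. is_basis F V (grade V t) Y)"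
  have Y: "hom_basis F T V = (\<Union>t\<in>T. B t)" by (simp add: hom_basis_def B_def)
  let ?Y = "\<Union>t\<in>T. B t"
  have B: "is_basis F V (grade V t) (B t)" if "t \<in> T" for t
    unfolding B_def using basis_exists[OF F V sub[OF that]] by (rule someI_ex)
  have Bg: "B t \<subseteq> grade V t" if "t \<in> T" for t using B[OF that] by (simp add: is_basis_def)
  have gV: "grade V t \<subseteq> carrier V" if "t \<in> T" for t using V.submoduleE(1)[OF sub[OF that]] .
  have YV: "?Y \<subseteq> carrier V" using Bg gV by blast
  have idY: "(\<lambda>y. y) \<in> ?Y \<rightarrow> carrier V" using YV by auto
  \<comment> \<open>A vector shared by two of the bases would be counted once in each component when
    coefficients are grouped.\<close>
  have disj: "s = t" if "s \<in> T" "t \<in> T" "y \<in> B s" "y \<in> B t" for s t y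
  proof (rule ccontr)
    assume "s \<noteq> t"
    then have "y = \<zero>\<^bsub>V\<^esub>"
      using direct_grading_inter[OF V dir that(1,2)] Bg[OF that(1)] Bg[OF that(2)] that(3,4) by auto
    then show False using is_basis_nonzero[OF F V B[OF that(1)] that(3)] by simp
  qed
  define part where "part = (\<lambda>c t. (\<lambda>y. if y \<in> B t then c y else \<zero>\<^bsub>F\<^esub>))"
  define fam where "fam = (\<lambda>c t. if t \<in> T then lincomb F V (part c t) else \<zero>\<^bsub>V\<^esub>)"
  have part: "part c t \<in> fin_coeffs F (B t)" if "c \<in> fin_coeffs F ?Y" for c t
  proof -
    have "{y. part c t y \<noteq> \<zero>\<^bsub>F\<^esub>} \<subseteq> {y. c y \<noteq> \<zero>\<^bsub>F\<^esub>}" by (auto simp: part_def)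
    then have "finite {y. part c t y \<noteq> \<zero>\<^bsub>F\<^esub>}" using that by (auto simp: fin_coeffs_def intro: finite_subset)
    then show ?thesis using that by (auto simp: fin_coeffs_def part_def)
  qed
  have fam: "fam c \<in> grade_families T V \<and> family_sum V (fam c) = lincomb F V c"
    if "c \<in> fin_coeffs F ?Y" for c
    using that
  proof (induction c rule: F.fin_coeffs_induct)
    case zero
    have "fam (\<lambda>_. \<zero>\<^bsub>F\<^esub>) = (\<lambda>_. \<zero>\<^bsub>V\<^esub>)"
      by (auto simp: fam_def part_def lincomb_eq_indexed)
    then show ?case
      using grade_families_zero[OF V sub] family_sum_zero[OF V] by (simp add: lincomb_eq_indexed)
  next
    case (single y a)
    then obtain t where t: "t \<in> T" "y \<in> B t" by auto
    have yV: "y \<in> carrier V" using t YV by auto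
    \<comment> \<open>By disjointness the one-term function contributes to exactly one
      component.\<close>
    have "part (single F y a) s = (if s = t then single F y a else (\<lambda>_. \<zero>\<^bsub>F\<^esub>))" if "s \<in> T" for s
    proof -
      have "y \<in> B s \<longleftrightarrow> s = t" using disj[OF that t(1) _ t(2)] t(2) by blast
      then show ?thesis by (auto simp: part_def single_def)
    qed
    then have "fam (single F y a) s = (if s = t then a \<odot>\<^bsub>V\<^esub> y else \<zero>\<^bsub>V\<^esub>)" for s
      using t single(2) yV by (simp add: fam_def lincomb_eq_indexed V.indexed_lincomb_single)
    then have "fam (single F y a) = (\<lambda>s. if s = t then a \<odot>\<^bsub>V\<^esub> y else \<zero>\<^bsub>V\<^esub>)" by (rule ext)
    moreover have "a \<odot>\<^bsub>V\<^esub> y \<in> grade V t"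
      using t Bg V.submoduleE(4)[OF sub[OF t(1)]] single by auto
    ultimately show ?case
      using grade_families_single[OF V sub t(1)] family_sum_single[OF V, of "a \<odot>\<^bsub>V\<^esub> y" t] single yV
      by (simp add: lincomb_eq_indexed V.indexed_lincomb_single)
  next
    case (add c d)
    have "fam (\<lambda>i. c i \<oplus>\<^bsub>F\<^esub> d i) t = fam c t \<oplus>\<^bsub>V\<^esub> fam d t" for t
    proof (cases "t \<in> T")
      case True
      have idB: "(\<lambda>y. y) \<in> B t \<rightarrow> carrier V" using Bg[OF True] gV[OF True] by auto
      have "part (\<lambda>i. c i \<oplus>\<^bsub>F\<^esub> d i) t = (\<lambda>i. part c t i \<oplus>\<^bsub>F\<^esub> part d t i)"
        by (auto simp: part_def)
      then show ?thesis using V.indexed_lincomb_add[OF part[OF add(1)] part[OF add(2)] idB] True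
        by (simp add: fam_def lincomb_eq_indexed)
    qed (simp add: fam_def)
    then have eq: "fam (\<lambda>i. c i \<oplus>\<^bsub>F\<^esub> d i) = (\<lambda>t. fam c t \<oplus>\<^bsub>V\<^esub> fam d t)" by auto
    show ?case unfolding eq
      using grade_families_add[OF V sub conjunct1[OF add.IH(1)] conjunct1[OF add.IH(2)]] add
        V.indexed_lincomb_add[OF add(1,2) idY] by (simp add: lincomb_eq_indexed)
  qed
  have indep: "\<forall>y\<in>?Y. c y = \<zero>\<^bsub>F\<^esub>" if c: "c \<in> fin_coeffs F ?Y" and z: "lincomb F V c = \<zero>\<^bsub>V\<^esub>" for c
  proof
    fix y assume "y \<in> ?Y"
    then obtain t where t: "t \<in> T" "y \<in> B t" by auto
    have "fam c = (\<lambda>_. \<zero>\<^bsub>V\<^esub>)"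
      using fam[OF c] z dir family_sum_zero[OF V] grade_families_zero[OF V sub]
      by (auto simp: direct_grading_def inj_on_def)
    then have "lincomb F V (part c t) = \<zero>\<^bsub>V\<^esub>" using t by (metis fam_def)
    then have "part c t y = \<zero>\<^bsub>F\<^esub>" using B[OF t(1)] part[OF c] t(2) unfolding is_basis_def by blast
    then show "c y = \<zero>\<^bsub>F\<^esub>" using t by (simp add: part_def)
  qed
  let ?H = "lincomb F V ` fin_coeffs F ?Y"
  have "submodule ?H F V"
  proof (rule V.submoduleI_smult)
    show "?H \<subseteq> carrier V" using V.indexed_lincomb_closed[OF _ idY] by (auto simp: lincomb_eq_indexed)
    show "\<zero>\<^bsub>V\<^esub> \<in> ?H"
      by (rule image_eqI[OF _ F.fin_coeffs_zero]) (simp add: lincomb_eq_indexed)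
    show "u \<oplus>\<^bsub>V\<^esub> v \<in> ?H" if uv: "u \<in> ?H" "v \<in> ?H" for u v
    proof -
      obtain c d where cd: "c \<in> fin_coeffs F ?Y" "d \<in> fin_coeffs F ?Y" "u = lincomb F V c" "v = lincomb F V d"
        using uv by blast
      show ?thesis
        by (rule image_eqI[OF _ F.fin_coeffs_add[OF cd(1,2)]])
           (simp add: cd lincomb_eq_indexed V.indexed_lincomb_add[OF cd(1,2) idY])
    qed
    show "a \<odot>\<^bsub>V\<^esub> u \<in> ?H" if au: "a \<in> carrier F" "u \<in> ?H" for a u
    proof -
      obtain c where c: "c \<in> fin_coeffs F ?Y" "u = lincomb F V c" using au by blast
      show ?thesis
        by (rule image_eqI[OF _ F.fin_coeffs_smult[OF c(1) au(1)]])
           (simp add: c lincomb_eq_indexed V.indexed_lincomb_smult[OF c(1) au(1) idY])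
    qed
  qed
  moreover have "grade V t \<subseteq> ?H" if t: "t \<in> T" for t
  proof
    fix v assume "v \<in> grade V t"
    then obtain c where "c \<in> fin_coeffs F (B t)" "v = lincomb F V c"
      using B[OF t] by (auto simp: is_basis_def)
    then show "v \<in> ?H" using fin_coeffs_mono[of c F "B t" ?Y] t by blast
  qed
  ultimately have "carrier V \<subseteq> ?H" using grade_total_least[OF V sub] tot by metis
  then show ?thesis unfolding Y using YV indep by (auto simp: is_basis_def)
qed

text \<open>These facts make the definite description in \<open>coords\<close> meaningful.
  Uniqueness follows by applying independence to the difference of two representations.\<close>

lemma coords_basis:
  assumes V: "module F V" and Y: "is_basis F V (carrier V) Y"
  shows "v \<in> carrier V \<Longrightarrow> coords F V Y v \<in> fin_coeffs F Y"
    and "v \<in> carrier V \<Longrightarrow> lincomb F V (coords F V Y v) = v"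
    and "c \<in> fin_coeffs F Y \<Longrightarrow> coords F V Y (lincomb F V c) = c"
proof -
  interpret V: module F V by fact
  have idY: "(\<lambda>y. y) \<in> Y \<rightarrow> carrier V" using Y by (auto simp: is_basis_def)
  have uniq: "c = d" if c: "c \<in> fin_coeffs F Y" and d: "d \<in> fin_coeffs F Y"
    and eq: "lincomb F V c = lincomb F V d" for c d
  proof -
    \<comment> \<open>Subtraction is written as adding a multiple by minus one, so that the rules
      for sums and scalar multiples of coefficients suffice.\<close>
    let ?m = "\<ominus>\<^bsub>F\<^esub> \<one>\<^bsub>F\<^esub>"
    have m: "?m \<in> carrier F" by simp
    let ?e = "\<lambda>y. c y \<oplus>\<^bsub>F\<^esub> ?m \<otimes>\<^bsub>F\<^esub> d y"
    have e: "?e \<in> fin_coeffs F Y"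
      by (rule V.fin_coeffs_add[OF c V.fin_coeffs_smult[OF d m]])
    have dV: "lincomb F V d \<in> carrier V" using V.indexed_lincomb_closed[OF d idY] by (simp add: lincomb_eq_indexed)
    have "lincomb F V ?e = lincomb F V d \<oplus>\<^bsub>V\<^esub> ?m \<odot>\<^bsub>V\<^esub> lincomb F V d"
      using eq V.indexed_lincomb_add[OF c V.fin_coeffs_smult[OF d m] idY]
        V.indexed_lincomb_smult[OF d m idY] by (simp add: lincomb_eq_indexed)
    also have "\<dots> = \<zero>\<^bsub>V\<^esub>" using dV by (simp add: V.smult_l_minus V.M.r_neg)
    finally have z: "\<forall>y\<in>Y. ?e y = \<zero>\<^bsub>F\<^esub>" using Y e by (auto simp: is_basis_def)
    show "c = d"
    proof
      fix y
      have cl: "c y \<in> carrier F" "d y \<in> carrier F" using c d by (auto simp: fin_coeffs_def)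
      show "c y = d y"
      proof (cases "y \<in> Y")
        case True
        then have "?e y = \<zero>\<^bsub>F\<^esub>" using z by blast
        then have "c y \<oplus>\<^bsub>F\<^esub> \<ominus>\<^bsub>F\<^esub> (d y) = \<zero>\<^bsub>F\<^esub>" using cl by (simp add: V.R.l_minus)
        then show ?thesis using cl V.R.minus_equality[of "c y" "\<ominus>\<^bsub>F\<^esub> (d y)"] by simp
      qed (use c d in \<open>auto simp: fin_coeffs_def\<close>)
    qed
  qed
  have ex: "coords F V Y v \<in> fin_coeffs F Y \<and> v = lincomb F V (coords F V Y v)" if v: "v \<in> carrier V" for v
  proof -
    obtain d where d: "d \<in> fin_coeffs F Y" "v = lincomb F V d" using Y v by (auto simp: is_basis_def)
    then have "\<exists>!c. c \<in> fin_coeffs F Y \<and> v = lincomb F V c" using uniq by (intro ex1I[of _ d]) simp_all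
    then show ?thesis unfolding coords_def by (rule theI')
  qed
  show "v \<in> carrier V \<Longrightarrow> coords F V Y v \<in> fin_coeffs F Y"
    and "v \<in> carrier V \<Longrightarrow> lincomb F V (coords F V Y v) = v" using ex by auto
  show "coords F V Y (lincomb F V c) = c" if c: "c \<in> fin_coeffs F Y"
    unfolding coords_def by (rule the_equality) (use uniq c in auto)
qed

text \<open>By uniqueness of coordinates, the right-hand side only has to be a coefficient function
  over \<open>Y\<close> that represents the vector on the left.\<close>

lemma coords_linear:
  assumes V: "module F V" and Y: "is_basis F V (carrier V) Y"
  shows "u \<in> carrier V \<Longrightarrow> v \<in> carrier V \<Longrightarrow>
      coords F V Y (u \<oplus>\<^bsub>V\<^esub> v) = (\<lambda>y. coords F V Y u y \<oplus>\<^bsub>F\<^esub> coords F V Y v y)"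
    and "a \<in> carrier F \<Longrightarrow> v \<in> carrier V \<Longrightarrow>
      coords F V Y (a \<odot>\<^bsub>V\<^esub> v) = (\<lambda>y. a \<otimes>\<^bsub>F\<^esub> coords F V Y v y)"
proof -
  interpret V: module F V by fact
  have idY: "(\<lambda>y. y) \<in> Y \<rightarrow> carrier V" using Y by (auto simp: is_basis_def)
  note C = coords_basis[OF V Y]
  show "coords F V Y (u \<oplus>\<^bsub>V\<^esub> v) = (\<lambda>y. coords F V Y u y \<oplus>\<^bsub>F\<^esub> coords F V Y v y)"
    if "u \<in> carrier V" "v \<in> carrier V"
    using V.indexed_lincomb_add[OF C(1)[OF that(1)] C(1)[OF that(2)] idY]
      C(2)[OF that(1)] C(2)[OF that(2)]
      C(3)[OF V.fin_coeffs_add[OF C(1)[OF that(1)] C(1)[OF that(2)]]]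
    by (simp add: lincomb_eq_indexed)
  show "coords F V Y (a \<odot>\<^bsub>V\<^esub> v) = (\<lambda>y. a \<otimes>\<^bsub>F\<^esub> coords F V Y v y)"
    if "a \<in> carrier F" "v \<in> carrier V"
    using V.indexed_lincomb_smult[OF C(1)[OF that(2)] that(1) idY] C(2)[OF that(2)]
      C(3)[OF V.fin_coeffs_smult[OF C(1)[OF that(2)] that(1)]]
    by (simp add: lincomb_eq_indexed)
qed

section \<open>Coding the free algebra\<close>

text \<open>Here \<open>p\<close> is meant as a pairing function, and the distinct elements
  \<open>a\<close> and \<open>b\<close> are tags that tell the two constructors apart. Lists are
  coded in the same way, with the second \<open>a\<close> for the empty list a mere filler.\<close>

primrec code_bword :: "('u \<times> 'u \<Rightarrow> 'u) \<Rightarrow> 'u \<Rightarrow> 'u \<Rightarrow> 'u bword \<Rightarrow> 'u" where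
  "code_bword p a b (Gen y) = p (a, y)"
| "code_bword p a b (Br l r) = p (b, p (code_bword p a b l, code_bword p a b r))"

primrec code_list :: "('u \<times> 'u \<Rightarrow> 'u) \<Rightarrow> 'u \<Rightarrow> 'u \<Rightarrow> 'u list \<Rightarrow> 'u" where
  "code_list p a b [] = p (a, a)"
| "code_list p a b (x # xs) = p (b, p (x, code_list p a b xs))"

lemma inj_code_bword:
  assumes p: "inj p" and ab: "a \<noteq> b"
  shows "inj (code_bword p a b)"
proof (rule injI)
  fix v w :: "'a bword"
  show "code_bword p a b v = code_bword p a b w \<Longrightarrow> v = w"
  proof (induction v arbitrary: w)
    case (Gen x)
    then show ?case using ab by (cases w) (auto simp: inj_eq[OF p])
  next
    case (Br l r)
    then show ?case using ab by (cases w) (auto simp: inj_eq[OF p])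
  qed
qed

lemma inj_code_list:
  assumes p: "inj p" and ab: "a \<noteq> b"
  shows "inj (code_list p a b)"
proof (rule injI)
  fix xs ys :: "'a list"
  show "code_list p a b xs = code_list p a b ys \<Longrightarrow> xs = ys"
  proof (induction xs arbitrary: ys)
    case Nil
    then show ?case using ab by (cases ys) (auto simp: inj_eq[OF p])
  next
    case (Cons x xs)
    then show ?case using ab by (cases ys) (auto simp: inj_eq[OF p])
  qed
qed

text \<open>A finitely supported function is determined by its finite set of pairs of a word and its
  nonzero coefficient. Each pair is coded by one element of \<open>'u\<close>, the resulting finite
  set is enumerated, and the list is coded.\<close>

lemma free_alg_codable:
  fixes F :: "('f, 'r) ring_scheme"
  assumes inf: "infinite (UNIV :: 'u set)" and le: "carrier F \<lesssim> (UNIV :: 'u set)"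
  shows "\<exists>e :: ('u bword \<Rightarrow> 'f) \<Rightarrow> 'u. inj_on e (carrier (free_alg F UNIV))"
proof -
  obtain p :: "'u \<times> 'u \<Rightarrow> 'u" where "bij_betw p (UNIV \<times> UNIV) UNIV"
    using card_of_Times_same_infinite[OF inf] unfolding card_of_ordIso[symmetric] by blast
  then have p: "inj p" by (simp add: bij_betw_def)
  obtain j :: "'f \<Rightarrow> 'u" where j: "inj_on j (carrier F)" using le by (auto simp: lepoll_def)
  obtain a b :: 'u where ab: "a \<noteq> b"
    using ex_new_if_finite[OF inf, of "{undefined}"] by auto
  define graph :: "('u bword \<Rightarrow> 'f) \<Rightarrow> 'u set" where
    "graph = (\<lambda>c. (\<lambda>w. p (code_bword p a b w, j (c w))) ` {w. c w \<noteq> \<zero>\<^bsub>F\<^esub>})"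
  \<comment> \<open>Any enumeration will do, since \<open>set\<close> recovers the finite set from
    it.\<close>
  define ls :: "'u set \<Rightarrow> 'u list" where "ls = (\<lambda>S. SOME xs. set xs = S)"
  have ls: "set (ls S) = S" if "finite S" for S
    unfolding ls_def using finite_list[OF that] by (rule someI_ex)
  \<comment> \<open>The graph sees only the support of \<open>c\<close>. Exchanging \<open>c\<close>
    and \<open>d\<close> covers the support of \<open>d\<close>, and elsewhere both vanish. Since
    \<open>j\<close> is injective only on scalars, both coefficients must be known to lie in
    \<open>carrier F\<close>.\<close>
  have graph_le: "c w = d w" if c: "c \<in> carrier (free_alg F UNIV)" and d: "d \<in> carrier (free_alg F UNIV)"
    and eq: "graph c = graph d" and w: "c w \<noteq> \<zero>\<^bsub>F\<^esub>" for c d w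
  proof -
    have "p (code_bword p a b w, j (c w)) \<in> graph d" using eq w by (auto simp: graph_def)
    then obtain v where v: "p (code_bword p a b w, j (c w)) = p (code_bword p a b v, j (d v))"
      by (auto simp: graph_def)
    then have "w = v" "j (c w) = j (d v)"
      using inj_eq[OF p] inj_eq[OF inj_code_bword[OF p ab]] by auto
    then show ?thesis using j c d by (auto simp: inj_on_def free_alg_def fin_coeffs_def)
  qed
  have "inj_on (\<lambda>c. code_list p a b (ls (graph c))) (carrier (free_alg F UNIV))"
  proof (rule inj_onI)
    fix c d assume c: "c \<in> carrier (free_alg F UNIV)" and d: "d \<in> carrier (free_alg F UNIV)"
      and "code_list p a b (ls (graph c)) = code_list p a b (ls (graph d))"
    then have "ls (graph c) = ls (graph d)" using inj_eq[OF inj_code_list[OF p ab]] by simp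
    moreover have "finite (graph c)" "finite (graph d)"
      using c d by (auto simp: graph_def free_alg_def fin_coeffs_def)
    ultimately have eq: "graph c = graph d" using ls by metis
    show "c = d"
    proof
      fix w
      show "c w = d w" using graph_le[OF c d eq, of w] graph_le[OF d c eq[symmetric], of w] by metis
    qed
  qed
  then show ?thesis by blast
qed

text \<open>Injectivity is stated for the words in all elements of the type, so it restricts to the
  words over every homogeneous basis.\<close>

lemma inj_encode:
  assumes "infinite (UNIV :: 'u set)" "carrier F \<lesssim> (UNIV :: 'u set)"
  shows "inj_on (encode F :: ('u bword \<Rightarrow> 'f) \<Rightarrow> 'u) (carrier (free_alg F UNIV))"
  unfolding encode_def using free_alg_codable[OF assms] by (rule someI_ex)

section \<open>The free non-associative algebra\<close>

abbreviation words :: "'y set \<Rightarrow> 'y bword set" where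
  "words Y \<equiv> {w. set_bword w \<subseteq> Y}"

lemma free_alg_simps [simp]:
  "carrier (free_alg F Y) = fin_coeffs F (words Y)"
  "\<zero>\<^bsub>free_alg F Y\<^esub> = (\<lambda>w. \<zero>\<^bsub>F\<^esub>)"
  "p \<oplus>\<^bsub>free_alg F Y\<^esub> q = (\<lambda>w. p w \<oplus>\<^bsub>F\<^esub> q w)"
  "a \<odot>\<^bsub>free_alg F Y\<^esub> p = (\<lambda>w. a \<otimes>\<^bsub>F\<^esub> p w)"
  by (simp_all add: free_alg_def)

text \<open>A bracketed word factors in at most one way, so this convolution has a single term for
  each word. Naming it exhibits a product that does not depend on the generating set.\<close>

definition conv :: "('f, 'r) ring_scheme \<Rightarrow> ('y bword \<Rightarrow> 'f) \<Rightarrow> ('y bword \<Rightarrow> 'f) \<Rightarrow> 'y bword \<Rightarrow> 'f" where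
  "conv F p q = (\<lambda>w. case w of Gen y \<Rightarrow> \<zero>\<^bsub>F\<^esub> | Br w1 w2 \<Rightarrow> p w1 \<otimes>\<^bsub>F\<^esub> q w2)"

lemma free_alg_mult [simp]: "p \<otimes>\<^bsub>free_alg F Y\<^esub> q = conv F p q"
  by (simp add: free_alg_def conv_def)

lemma fin_coeffs_carrier: "c \<in> fin_coeffs F I \<Longrightarrow> c i \<in> carrier F"
  by (simp add: fin_coeffs_def)

section \<open>Multiplication of finitely supported functions on words\<close>

context cring
begin

text \<open>A word in the support of the product is a bracket of one word from each support, which
  bounds the support and the letters that occur in it.\<close>

lemma conv_closed:
  assumes p: "p \<in> fin_coeffs R (words Y)" and q: "q \<in> fin_coeffs R (words Y)"
  shows "conv R p q \<in> fin_coeffs R (words Y)"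
proof -
  have "{w. conv R p q w \<noteq> \<zero>} \<subseteq> (\<lambda>(u, v). Br u v) ` ({u. p u \<noteq> \<zero>} \<times> {v. q v \<noteq> \<zero>})"
  proof
    fix w assume "w \<in> {w. conv R p q w \<noteq> \<zero>}"
    then show "w \<in> (\<lambda>(u, v). Br u v) ` ({u. p u \<noteq> \<zero>} \<times> {v. q v \<noteq> \<zero>})"
      using fin_coeffs_carrier[OF p] fin_coeffs_carrier[OF q]
      by (cases w) (auto simp: conv_def image_iff)
  qed
  moreover have "finite \<dots>" using p q by (auto simp: fin_coeffs_def)
  ultimately have "finite {w. conv R p q w \<noteq> \<zero>}" by (rule finite_subset)
  moreover have "conv R p q w = \<zero>" if "\<not> set_bword w \<subseteq> Y" for w
  proof (cases w)
    case (Br u v)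
    then have "p u = \<zero> \<or> q v = \<zero>" using p q that by (auto simp: fin_coeffs_def)
    then show ?thesis using Br fin_coeffs_carrier[OF p] fin_coeffs_carrier[OF q] by (auto simp: conv_def)
  qed (simp add: conv_def)
  moreover have "conv R p q w \<in> carrier R" for w
    using fin_coeffs_carrier[OF p] fin_coeffs_carrier[OF q] by (auto simp: conv_def split: bword.splits)
  ultimately show ?thesis by (auto simp: fin_coeffs_def)
qed

lemma conv_distr:
  assumes "p \<in> fin_coeffs R I" "p' \<in> fin_coeffs R I" "q \<in> fin_coeffs R J" "q' \<in> fin_coeffs R J"
  shows "conv R (\<lambda>w. p w \<oplus> p' w) q = (\<lambda>w. conv R p q w \<oplus> conv R p' q w)"
    and "conv R p (\<lambda>w. q w \<oplus> q' w) = (\<lambda>w. conv R p q w \<oplus> conv R p q' w)"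
  using assms[THEN fin_coeffs_carrier]
  by (auto simp: conv_def fun_eq_iff l_distr r_distr split: bword.splits)

lemma conv_smult:
  assumes "p \<in> fin_coeffs R I" "q \<in> fin_coeffs R J" "a \<in> carrier R"
  shows "conv R (\<lambda>w. a \<otimes> p w) q = (\<lambda>w. a \<otimes> conv R p q w)"
    and "conv R p (\<lambda>w. a \<otimes> q w) = (\<lambda>w. a \<otimes> conv R p q w)"
  using assms(1,2)[THEN fin_coeffs_carrier] assms(3)
  by (auto simp: conv_def fun_eq_iff m_assoc m_lcomm split: bword.splits)

lemma conv_zero:
  assumes "p \<in> fin_coeffs R I"
  shows "conv R (\<lambda>_. \<zero>) p = (\<lambda>_. \<zero>)" and "conv R p (\<lambda>_. \<zero>) = (\<lambda>_. \<zero>)"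
  using assms[THEN fin_coeffs_carrier]
  by (auto simp: conv_def fun_eq_iff split: bword.splits)

lemma conv_single:
  assumes "a \<in> carrier R" "b \<in> carrier R"
  shows "conv R (single R u a) (single R v b) = single R (Br u v) (a \<otimes> b)"
  using assms by (auto simp: conv_def single_def fun_eq_iff split: bword.splits)

lemma module_free_alg: "module R (free_alg R Y)"
proof (rule moduleI)
  show "abelian_group (free_alg R Y)"
  proof (rule abelian_groupI)
    fix p assume p: "p \<in> carrier (free_alg R Y)"
    then have "(\<lambda>w. \<ominus> \<one> \<otimes> p w) \<in> carrier (free_alg R Y)" by (simp add: fin_coeffs_smult)
    moreover have "(\<lambda>w. \<ominus> \<one> \<otimes> p w) \<oplus>\<^bsub>free_alg R Y\<^esub> p = \<zero>\<^bsub>free_alg R Y\<^esub>"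
      using p by (auto simp: fin_coeffs_carrier l_minus l_neg)
    ultimately show "\<exists>q\<in>carrier (free_alg R Y). q \<oplus>\<^bsub>free_alg R Y\<^esub> p = \<zero>\<^bsub>free_alg R Y\<^esub>" by blast
  qed (auto simp: fin_coeffs_add fin_coeffs_zero fin_coeffs_carrier a_ac)
qed (auto simp: fin_coeffs_smult fin_coeffs_carrier l_distr r_distr m_assoc is_cring)

lemma nonassoc_free_alg: "nonassoc_algebra R (free_alg R Y)"
  by (auto simp: nonassoc_algebra_def module_free_alg conv_closed conv_distr conv_smult)

end

text \<open>The axioms pass to a homomorphic image: equations are carried over, and the image of a
  negative is a negative. With \<open>encode F\<close> as \<open>e\<close>, this makes
  \<open>KV\<close> an algebra.\<close>

lemma nonassoc_algebra_image:
  assumes A: "nonassoc_algebra F A"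
    and carr: "carrier B = e ` carrier A" and zero: "\<zero>\<^bsub>B\<^esub> = e \<zero>\<^bsub>A\<^esub>"
    and add: "\<And>x y. x \<in> carrier A \<Longrightarrow> y \<in> carrier A \<Longrightarrow> e x \<oplus>\<^bsub>B\<^esub> e y = e (x \<oplus>\<^bsub>A\<^esub> y)"
    and mult: "\<And>x y. x \<in> carrier A \<Longrightarrow> y \<in> carrier A \<Longrightarrow> e x \<otimes>\<^bsub>B\<^esub> e y = e (x \<otimes>\<^bsub>A\<^esub> y)"
    and smult: "\<And>a x. a \<in> carrier F \<Longrightarrow> x \<in> carrier A \<Longrightarrow> a \<odot>\<^bsub>B\<^esub> e x = e (a \<odot>\<^bsub>A\<^esub> x)"
  shows "nonassoc_algebra F B"
proof -
  interpret A: module F A using A by (simp add: nonassoc_algebra_def)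
  have mc: "\<And>x y. x \<in> carrier A \<Longrightarrow> y \<in> carrier A \<Longrightarrow> x \<otimes>\<^bsub>A\<^esub> y \<in> carrier A"
    using A by (simp add: nonassoc_algebra_def)
  have "module F B"
  proof (rule moduleI)
    show "abelian_group B"
    proof (rule abelian_groupI)
      fix x assume "x \<in> carrier B"
      then obtain u where u: "u \<in> carrier A" "x = e u" by (auto simp: carr)
      then have "e (\<ominus>\<^bsub>A\<^esub> u) \<in> carrier B" "e (\<ominus>\<^bsub>A\<^esub> u) \<oplus>\<^bsub>B\<^esub> x = \<zero>\<^bsub>B\<^esub>"
        by (auto simp: carr add zero A.M.l_neg)
      then show "\<exists>y\<in>carrier B. y \<oplus>\<^bsub>B\<^esub> x = \<zero>\<^bsub>B\<^esub>" by blast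
    qed (auto simp: carr add zero A.M.a_ac)
  qed (auto simp: carr add smult A.smult_l_distr A.smult_r_distr A.smult_assoc1 A.R.is_cring)
  then show ?thesis using A mc unfolding nonassoc_algebra_def
    by (auto simp: carr add mult smult)
qed

section \<open>Homomorphisms from the free algebra\<close>

text \<open>The extension of \<open>g\<close> to a homomorphism from the free magma into the
  multiplicative magma of \<open>A\<close>.\<close>

primrec eval_bword :: "('u, 'v) monoid_scheme \<Rightarrow> ('y \<Rightarrow> 'u) \<Rightarrow> 'y bword \<Rightarrow> 'u" where
  "eval_bword A g (Gen y) = g y"
| "eval_bword A g (Br l r) = eval_bword A g l \<otimes>\<^bsub>A\<^esub> eval_bword A g r"

lemma eval_bword_closed:
  assumes "nonassoc_algebra F A" "g \<in> Y \<rightarrow> carrier A"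
  shows "eval_bword A g \<in> words Y \<rightarrow> carrier A"
proof -
  have "set_bword w \<subseteq> Y \<Longrightarrow> eval_bword A g w \<in> carrier A" for w
    using assms by (induction w) (auto simp: nonassoc_algebra_def)
  then show ?thesis by auto
qed

text \<open>Both sides are additive in \<open>p\<close> and in \<open>q\<close>, so a double
  induction reduces to multiples of single words. For these it is the recursion of
  \<open>eval_bword\<close>, once the two scalars are pulled out of the product.\<close>

lemma free_alg_lift_mult:
  assumes A: "nonassoc_algebra F A" and g: "g \<in> Y \<rightarrow> carrier A"
    and p: "p \<in> fin_coeffs F (words Y)" and q: "q \<in> fin_coeffs F (words Y)"
  shows "indexed_lincomb F A (eval_bword A g) (conv F p q) =
    indexed_lincomb F A (eval_bword A g) p \<otimes>\<^bsub>A\<^esub> indexed_lincomb F A (eval_bword A g) q"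
proof -
  let ?E = "indexed_lincomb F A (eval_bword A g)"
  interpret A: module F A using A by (simp add: nonassoc_algebra_def)
  note ev = eval_bword_closed[OF A g]
  have cl: "x \<otimes>\<^bsub>A\<^esub> y \<in> carrier A" if "x \<in> carrier A" "y \<in> carrier A" for x y
    using A that by (simp add: nonassoc_algebra_def)
  have distr: "(x \<oplus>\<^bsub>A\<^esub> y) \<otimes>\<^bsub>A\<^esub> z = (x \<otimes>\<^bsub>A\<^esub> z) \<oplus>\<^bsub>A\<^esub> (y \<otimes>\<^bsub>A\<^esub> z)"
    "z \<otimes>\<^bsub>A\<^esub> (x \<oplus>\<^bsub>A\<^esub> y) = (z \<otimes>\<^bsub>A\<^esub> x) \<oplus>\<^bsub>A\<^esub> (z \<otimes>\<^bsub>A\<^esub> y)"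
    if "x \<in> carrier A" "y \<in> carrier A" "z \<in> carrier A" for x y z
    using A that by (simp_all add: nonassoc_algebra_def)
  have sm: "(a \<odot>\<^bsub>A\<^esub> x) \<otimes>\<^bsub>A\<^esub> y = a \<odot>\<^bsub>A\<^esub> (x \<otimes>\<^bsub>A\<^esub> y)"
    "x \<otimes>\<^bsub>A\<^esub> (a \<odot>\<^bsub>A\<^esub> y) = a \<odot>\<^bsub>A\<^esub> (x \<otimes>\<^bsub>A\<^esub> y)"
    if "a \<in> carrier F" "x \<in> carrier A" "y \<in> carrier A" for a x y
    using A that by (simp_all add: nonassoc_algebra_def)
  \<comment> \<open>Absorption by zero is not among the axioms of \<open>nonassoc_algebra\<close>;
    it is compatibility with the scalar zero.\<close>
  have zl: "\<zero>\<^bsub>A\<^esub> \<otimes>\<^bsub>A\<^esub> x = \<zero>\<^bsub>A\<^esub>" and zr: "x \<otimes>\<^bsub>A\<^esub> \<zero>\<^bsub>A\<^esub> = \<zero>\<^bsub>A\<^esub>" if "x \<in> carrier A" for x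
    using sm(1)[of "\<zero>\<^bsub>F\<^esub>" "\<zero>\<^bsub>A\<^esub>" x] sm(2)[of "\<zero>\<^bsub>F\<^esub>" x "\<zero>\<^bsub>A\<^esub>"] that cl by simp_all
  note E = A.indexed_lincomb_closed[OF _ ev]
  show ?thesis using p
  proof (induction p rule: A.fin_coeffs_induct)
    case zero
    then show ?case using A.conv_zero[OF q] zl E[OF q] by simp
  next
    case (single u a)
    then have ua: "eval_bword A g u \<in> carrier A" using ev by auto
    show ?case using q
    proof (induction q rule: A.fin_coeffs_induct)
      case zero
      then show ?case
        using A.conv_zero(2)[OF A.fin_coeffs_single[OF single]] zr E[OF A.fin_coeffs_single[OF single]] by simp
    next
      case (single v b)
      then have vb: "eval_bword A g v \<in> carrier A" using ev by auto
      show ?case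
        using ua vb \<open>a \<in> carrier F\<close> \<open>b \<in> carrier F\<close>
          A.smult_assoc1[of b a] A.R.m_comm[of a b]
        by (simp add: A.conv_single A.indexed_lincomb_single cl sm A.smult_assoc1)
    next
      case (add c d)
      note s = A.fin_coeffs_single[OF single]
      show ?case
        using A.conv_distr(2)[OF s s add(1,2)] add.IH
          A.indexed_lincomb_add[OF A.conv_closed[OF s add(1)] A.conv_closed[OF s add(2)] ev]
          A.indexed_lincomb_add[OF add(1,2) ev] distr(2)[OF E[OF add(1)] E[OF add(2)] E[OF s]]
        by simp
    qed
  next
    case (add c d)
    show ?case
      using A.conv_distr(1)[OF add(1,2) q q] add.IH
        A.indexed_lincomb_add[OF A.conv_closed[OF add(1) q] A.conv_closed[OF add(2) q] ev]
        A.indexed_lincomb_add[OF add(1,2) ev] distr(1)[OF E[OF add(1)] E[OF add(2)] E[OF q]]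
      by simp
  qed
qed

text \<open>The inclusion of \<open>V\<close> into \<open>KV\<close> before coding, on the level of
  coordinates; see \<open>K_incl_eq\<close>.\<close>

definition degree_one :: "('f, 'r) ring_scheme \<Rightarrow> ('y \<Rightarrow> 'f) \<Rightarrow> 'y bword \<Rightarrow> 'f" where
  "degree_one F c = (\<lambda>w. case w of Gen y \<Rightarrow> c y | Br w1 w2 \<Rightarrow> \<zero>\<^bsub>F\<^esub>)"

lemma degree_one_zero: "degree_one F (\<lambda>_. \<zero>\<^bsub>F\<^esub>) = (\<lambda>_. \<zero>\<^bsub>F\<^esub>)"
  by (auto simp: degree_one_def fun_eq_iff split: bword.splits)

lemma degree_one_single: "degree_one F (single F y a) = single F (Gen y) a"
  by (auto simp: degree_one_def single_def fun_eq_iff split: bword.splits)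

lemma degree_one_closed:
  assumes "cring F" "c \<in> fin_coeffs F Y"
  shows "degree_one F c \<in> fin_coeffs F (words Y)"
proof -
  interpret cring F by fact
  have "{w. degree_one F c w \<noteq> \<zero>\<^bsub>F\<^esub>} \<subseteq> Gen ` {y. c y \<noteq> \<zero>\<^bsub>F\<^esub>}"
  proof
    fix w assume "w \<in> {w. degree_one F c w \<noteq> \<zero>\<^bsub>F\<^esub>}"
    then show "w \<in> Gen ` {y. c y \<noteq> \<zero>\<^bsub>F\<^esub>}" by (cases w) (auto simp: degree_one_def)
  qed
  then have "finite {w. degree_one F c w \<noteq> \<zero>\<^bsub>F\<^esub>}"
    using assms(2) by (auto simp: fin_coeffs_def intro: finite_subset)
  then show ?thesis using assms(2) by (auto simp: fin_coeffs_def degree_one_def split: bword.splits)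
qed

text \<open>A one-letter word evaluates to \<open>g\<close> of its letter. Hence the lift of a
  linear map restricts to that map on \<open>V\<close>.\<close>

lemma indexed_lincomb_degree_one:
  assumes A: "nonassoc_algebra F A" and g: "g \<in> Y \<rightarrow> carrier A" and c: "c \<in> fin_coeffs F Y"
  shows "indexed_lincomb F A (eval_bword A g) (degree_one F c) = indexed_lincomb F A g c"
proof -
  interpret A: module F A using A by (simp add: nonassoc_algebra_def)
  note ev = eval_bword_closed[OF A g]
  note d1 = degree_one_closed[OF A.R.is_cring]
  show ?thesis using c
  proof (induction c rule: A.fin_coeffs_induct)
    case zero
    then show ?case by (simp add: degree_one_zero)
  next
    case (single y a)
    then have "g y \<in> carrier A" using g by auto
    then show ?case using single by (simp add: degree_one_single A.indexed_lincomb_single)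
  next
    case (add c d)
    have "degree_one F (\<lambda>y. c y \<oplus>\<^bsub>F\<^esub> d y) = (\<lambda>w. degree_one F c w \<oplus>\<^bsub>F\<^esub> degree_one F d w)"
      by (auto simp: degree_one_def fun_eq_iff split: bword.splits)
    then show ?case
      using add.IH A.indexed_lincomb_add[OF add(1,2) g] A.indexed_lincomb_add[OF d1[OF add(1)] d1[OF add(2)] ev]
      by simp
  qed
qed

section \<open>The object part of the free functor\<close>

lemma alg_homsD:
  assumes "\<psi> \<in> alg_homs F A B"
  shows "\<psi> \<in> lin_maps F A B"
    and "x \<in> carrier A \<Longrightarrow> y \<in> carrier A \<Longrightarrow> \<psi> (x \<otimes>\<^bsub>A\<^esub> y) = \<psi> x \<otimes>\<^bsub>B\<^esub> \<psi> y"
  using assms by (auto simp: alg_homs_def)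

lemma K_obj_simps:
  "carrier (K_obj F T V) = encode F ` fin_coeffs F (words (hom_basis F T V))"
  "\<zero>\<^bsub>K_obj F T V\<^esub> = encode F (\<lambda>_. \<zero>\<^bsub>F\<^esub>)"
  "grade (K_obj F T V) t = K_incl F T V ` grade V t"
  by (simp_all add: K_obj_def Let_def)

lemma K_incl_eq: "K_incl F T V v = encode F (degree_one F (coords F V (hom_basis F T V) v))"
  by (simp add: K_incl_def degree_one_def)

lemma direct_grading_subset:
  assumes "module F V" "direct_grading F T V" "t \<in> T"
  shows "grade V t \<subseteq> carrier V"
proof -
  have "submodule (grade V t) F V" using assms(2,3) by (simp add: direct_grading_def)
  then show ?thesis by (rule module.submoduleE(1)[OF assms(1)])
qed

lemma graded_spaceD:
  assumes "graded_space F T V"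
  shows "module F V" "direct_grading F T V" "t \<in> T \<Longrightarrow> grade V t \<subseteq> carrier V"
proof -
  show V: "module F V" "direct_grading F T V" using assms by (simp_all add: graded_space_def)
  show "t \<in> T \<Longrightarrow> grade V t \<subseteq> carrier V" by (rule direct_grading_subset[OF V])
qed

section \<open>The algebra \<open>KV\<close> of a fixed graded space and its universal
  property\<close>

context
  fixes F :: "('f, 'r) ring_scheme" and T :: "'t set" and V :: "('f, 'u, 't) graded_module"
  assumes F: "field F"
    and inj: "inj_on (encode F :: ('u bword \<Rightarrow> 'f) \<Rightarrow> 'u) (carrier (free_alg F UNIV))"
    and gs: "graded_space F T V"
begin

interpretation F: field F by (fact F)

interpretation V: module F V using gs by (simp add: graded_space_def)

private abbreviation "Y \<equiv> hom_basis F T V"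

private abbreviation (input) "e \<equiv> (encode F :: ('u bword \<Rightarrow> 'f) \<Rightarrow> 'u)"

lemma decode_encode:
  assumes "p \<in> fin_coeffs F (words Y)"
  shows "decode F (encode F p :: 'u) = p"
  unfolding decode_def using fin_coeffs_mono[OF assms, of UNIV] by (intro inv_into_f_f[OF inj]) simp

lemma K_obj_ops:
  assumes "p \<in> fin_coeffs F (words Y)"
  shows "q \<in> fin_coeffs F (words Y) \<Longrightarrow> e p \<oplus>\<^bsub>K_obj F T V\<^esub> e q = e (\<lambda>w. p w \<oplus>\<^bsub>F\<^esub> q w)"
    and "q \<in> fin_coeffs F (words Y) \<Longrightarrow> e p \<otimes>\<^bsub>K_obj F T V\<^esub> e q = e (conv F p q)"
    and "a \<odot>\<^bsub>K_obj F T V\<^esub> e p = e (\<lambda>w. a \<otimes>\<^bsub>F\<^esub> p w)"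
  using assms by (simp_all add: K_obj_def Let_def decode_encode)

lemma nonassoc_K_obj: "nonassoc_algebra F (K_obj F T V)"
  by (rule nonassoc_algebra_image[OF F.nonassoc_free_alg[of Y], where e = "encode F"])
     (simp_all add: K_obj_simps K_obj_ops)

lemma module_K_obj: "module F (K_obj F T V)"
  using nonassoc_K_obj by (simp add: nonassoc_algebra_def)

private lemma basis: "is_basis F V (carrier V) Y"
  by (rule hom_basis_is_basis[OF F gs])

private lemmas C = coords_basis[OF V.module_axioms basis]

private lemmas d1 = degree_one_closed[OF F.is_cring]

lemma K_incl_closed: "v \<in> carrier V \<Longrightarrow> K_incl F T V v \<in> carrier (K_obj F T V)"
  using d1[OF C(1)] by (simp add: K_incl_eq K_obj_simps)

text \<open>Membership in \<open>lin_maps\<close> requires extensionality, which the total function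
  \<open>K_incl\<close> does not provide; hence the restriction.\<close>

lemma K_incl_linear: "restrict (K_incl F T V) (carrier V) \<in> lin_maps F V (K_obj F T V)"
proof (rule lin_maps_restrictI[OF V.module_axioms])
  show "K_incl F T V (u \<oplus>\<^bsub>V\<^esub> v) = K_incl F T V u \<oplus>\<^bsub>K_obj F T V\<^esub> K_incl F T V v"
    if "u \<in> carrier V" "v \<in> carrier V" for u v
    using that d1[OF C(1)]
    by (simp add: K_incl_eq K_obj_ops coords_linear[OF V.module_axioms basis])
       (auto intro!: arg_cong[where f = "encode F"] simp: degree_one_def fun_eq_iff split: bword.splits)
  show "K_incl F T V (a \<odot>\<^bsub>V\<^esub> v) = a \<odot>\<^bsub>K_obj F T V\<^esub> K_incl F T V v"
    if "a \<in> carrier F" "v \<in> carrier V" for a v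
    using that d1[OF C(1)]
    by (simp add: K_incl_eq K_obj_ops coords_linear[OF V.module_axioms basis])
       (auto intro!: arg_cong[where f = "encode F"] simp: degree_one_def fun_eq_iff split: bword.splits)
qed (rule K_incl_closed)

lemma K_incl_inj: "inj_on (restrict (K_incl F T V) (carrier V)) (carrier V)"
proof (rule inj_onI)
  fix u v assume u: "u \<in> carrier V" and v: "v \<in> carrier V"
    and "restrict (K_incl F T V) (carrier V) u = restrict (K_incl F T V) (carrier V) v"
  then have "e (degree_one F (coords F V Y u)) = e (degree_one F (coords F V Y v))"
    by (simp add: K_incl_eq)
  then have "degree_one F (coords F V Y u) = degree_one F (coords F V Y v)"
    using decode_encode[OF d1[OF C(1)[OF u]]] decode_encode[OF d1[OF C(1)[OF v]]] by metis
  then have "degree_one F (coords F V Y u) (Gen y) = degree_one F (coords F V Y v) (Gen y)" for y by simp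
  then have "coords F V Y u = coords F V Y v" by (auto simp: degree_one_def)
  then show "u = v" using C(2)[OF u] C(2)[OF v] by metis
qed

text \<open>The components of \<open>KV\<close> are images of those of \<open>V\<close> under an
  injective linear map, so their sum stays direct.\<close>

lemma pgr_K_obj: "pgr_algebra F T (K_obj F T V)"
proof -
  have dir: "direct_grading F T V" using gs by (simp add: graded_space_def)
  have "grade (K_obj F T V) t = restrict (K_incl F T V) (carrier V) ` grade V t" if "t \<in> T" for t
    unfolding K_obj_simps
    by (rule image_cong) (use direct_grading_subset[OF V.module_axioms dir that] in auto)
  then have "direct_grading F T (K_obj F T V)"
    by (rule direct_grading_image[OF V.module_axioms module_K_obj K_incl_linear K_incl_inj dir])
  then show ?thesis using nonassoc_K_obj by (simp add: pgr_algebra_def)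
qed

text \<open>The target is a bare algebra, so that the lemma serves both an arbitrary object
  \<open>A\<close> in the adjunction and \<open>K_obj F T W\<close> in the construction of
  \<open>K_hom\<close>.\<close>

lemma K_universal_ex:
  assumes A: "nonassoc_algebra F A" and \<phi>: "\<phi> \<in> lin_maps F V A"
  shows "\<exists>\<psi>\<in>alg_homs F (K_obj F T V) A. \<forall>v\<in>carrier V. \<psi> (K_incl F T V v) = \<phi> v"
proof -
  interpret A: module F A using A by (simp add: nonassoc_algebra_def)
  have idY: "(\<lambda>y. y) \<in> Y \<rightarrow> carrier V" using basis by (auto simp: is_basis_def)
  then have gA: "\<phi> \<in> Y \<rightarrow> carrier A" using lin_mapsD(1)[OF \<phi>] by auto
  note ev = eval_bword_closed[OF A gA]
  let ?E = "indexed_lincomb F A (eval_bword A \<phi>)"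
  define \<psi> where "\<psi> = restrict (\<lambda>x. ?E (decode F x)) (carrier (K_obj F T V))"
  have \<psi>: "\<psi> (encode F p) = ?E p" if "p \<in> fin_coeffs F (words Y)" for p
    using that by (simp add: \<psi>_def K_obj_simps decode_encode)
  have "\<psi> \<in> lin_maps F (K_obj F T V) A"
    unfolding \<psi>_def
    by (rule lin_maps_restrictI[OF module_K_obj])
       (auto simp: K_obj_simps K_obj_ops decode_encode F.fin_coeffs_add F.fin_coeffs_smult
          A.indexed_lincomb_closed[OF _ ev] A.indexed_lincomb_add[OF _ _ ev] A.indexed_lincomb_smult[OF _ _ ev])
  moreover have "\<psi> (x \<otimes>\<^bsub>K_obj F T V\<^esub> y) = \<psi> x \<otimes>\<^bsub>A\<^esub> \<psi> y"
    if "x \<in> carrier (K_obj F T V)" "y \<in> carrier (K_obj F T V)" for x y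
    using that by (auto simp: K_obj_simps K_obj_ops \<psi> F.conv_closed free_alg_lift_mult[OF A gA])
  ultimately have "\<psi> \<in> alg_homs F (K_obj F T V) A" by (simp add: alg_homs_def)
  moreover have "\<psi> (K_incl F T V v) = \<phi> v" if v: "v \<in> carrier V" for v
  proof -
    \<comment> \<open>In degree one the lift combines the values of \<open>\<phi>\<close> on the
      basis with the coordinates of \<open>v\<close>, and by linearity this is
      \<open>\<phi> v\<close>.\<close>
    have "\<psi> (K_incl F T V v) = indexed_lincomb F A \<phi> (coords F V Y v)"
      using d1[OF C(1)[OF v]] indexed_lincomb_degree_one[OF A gA C(1)[OF v]] by (simp add: K_incl_eq \<psi>)
    also have "\<dots> = \<phi> (lincomb F V (coords F V Y v))"
      using lin_maps_indexed_lincomb[OF V.module_axioms A.module_axioms \<phi> C(1)[OF v] idY]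
      by (simp add: lincomb_eq_indexed)
    finally show ?thesis using C(2)[OF v] by simp
  qed
  ultimately show ?thesis by blast
qed

text \<open>\<open>KV\<close> is generated by its degree 1 part: induction on words gives agreement
  on each word with coefficient one, and linearity extends it to all elements.\<close>

lemma K_universal_unique:
  assumes A: "nonassoc_algebra F A"
    and \<psi>: "\<psi> \<in> alg_homs F (K_obj F T V) A" and \<chi>: "\<chi> \<in> alg_homs F (K_obj F T V) A"
    and eq: "\<And>v. v \<in> carrier V \<Longrightarrow> \<psi> (K_incl F T V v) = \<chi> (K_incl F T V v)"
  shows "\<psi> = \<chi>"
proof -
  interpret A: module F A using A by (simp add: nonassoc_algebra_def)
  note L = lin_mapsD[OF alg_homsD(1)[OF \<psi>]] lin_mapsD[OF alg_homsD(1)[OF \<chi>]]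
  note Z = lin_maps_zero[OF module_K_obj A.module_axioms alg_homsD(1)[OF \<psi>]]
    lin_maps_zero[OF module_K_obj A.module_axioms alg_homsD(1)[OF \<chi>]]
  have carr: "e p \<in> carrier (K_obj F T V)" if "p \<in> fin_coeffs F (words Y)" for p
    using that by (simp add: K_obj_simps)
  have s: "single F w a \<in> fin_coeffs F (words Y)" if "set_bword w \<subseteq> Y" "a \<in> carrier F" for w a
    using that by (simp add: F.fin_coeffs_single)
  have gen: "\<psi> (e (single F w \<one>\<^bsub>F\<^esub>)) = \<chi> (e (single F w \<one>\<^bsub>F\<^esub>))" if "set_bword w \<subseteq> Y" for w
    using that
  proof (induction w)
    case (Gen y)
    then have y: "y \<in> Y" "y \<in> carrier V" using basis by (auto simp: is_basis_def)
    \<comment> \<open>A basis vector has itself as its only coordinate, so \<open>K_incl\<close>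
      sends it to the one-letter word, where \<open>eq\<close> applies.\<close>
    have "lincomb F V (single F y \<one>\<^bsub>F\<^esub>) = y"
      using y by (simp add: lincomb_eq_indexed V.indexed_lincomb_single)
    then have "coords F V Y y = single F y \<one>\<^bsub>F\<^esub>"
      using C(3)[OF F.fin_coeffs_single[OF y(1), of "\<one>\<^bsub>F\<^esub>"]] by simp
    then have "K_incl F T V y = e (single F (Gen y) \<one>\<^bsub>F\<^esub>)"
      by (simp add: K_incl_eq degree_one_single)
    then show ?case using eq[OF y(2)] by simp
  next
    case (Br u v)
    then have uv: "set_bword u \<subseteq> Y" "set_bword v \<subseteq> Y" by auto
    have "e (single F (Br u v) \<one>\<^bsub>F\<^esub>) = e (single F u \<one>\<^bsub>F\<^esub>) \<otimes>\<^bsub>K_obj F T V\<^esub> e (single F v \<one>\<^bsub>F\<^esub>)"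
      using s[OF uv(1), of "\<one>\<^bsub>F\<^esub>"] s[OF uv(2), of "\<one>\<^bsub>F\<^esub>"] by (simp add: K_obj_ops F.conv_single)
    then show ?case
      using Br uv alg_homsD(2)[OF \<psi>] alg_homsD(2)[OF \<chi>] carr s by simp
  qed
  have "\<psi> (e p) = \<chi> (e p)" if "p \<in> fin_coeffs F (words Y)" for p
    using that
  proof (induction p rule: F.fin_coeffs_induct)
    case zero
    then show ?case using Z by (simp add: K_obj_simps)
  next
    case (single w a)
    then have w: "set_bword w \<subseteq> Y" by simp
    have "single F w a = (\<lambda>v. a \<otimes>\<^bsub>F\<^esub> single F w \<one>\<^bsub>F\<^esub> v)"
      using single by (auto simp: single_def)
    then have "e (single F w a) = a \<odot>\<^bsub>K_obj F T V\<^esub> e (single F w \<one>\<^bsub>F\<^esub>)"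
      using s[OF w, of "\<one>\<^bsub>F\<^esub>"] by (simp add: K_obj_ops)
    then show ?case using gen[OF w] L single(2) carr[OF s[OF w, of "\<one>\<^bsub>F\<^esub>"]] by simp
  next
    case (add p q)
    have "\<psi> (e p \<oplus>\<^bsub>K_obj F T V\<^esub> e q) = \<chi> (e p \<oplus>\<^bsub>K_obj F T V\<^esub> e q)"
      using L(2,6)[OF carr[OF add(1)] carr[OF add(2)]] add.IH by simp
    then show ?case by (simp add: K_obj_ops[OF add(1)] add(2))
  qed
  then show ?thesis
    by (intro extensionalityI[OF L(4) L(8)]) (auto simp: K_obj_simps)
qed

end

section \<open>The two categories\<close>

lemma compose_restrict_id:
  assumes "f \<in> extensional A" "\<And>x. x \<in> A \<Longrightarrow> f x \<in> B"
  shows "compose A f (restrict id A) = f" "compose A (restrict id B) f = f"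
  using assms by (auto simp: compose_def extensional_def restrict_def fun_eq_iff)

lemma lin_maps_id: "module F V \<Longrightarrow> restrict id (carrier V) \<in> lin_maps F V V"
  by (rule lin_maps_restrictI) auto

lemma alg_homs_id: "nonassoc_algebra F A \<Longrightarrow> restrict id (carrier A) \<in> alg_homs F A A"
  using lin_maps_id[of F A] by (auto simp: alg_homs_def nonassoc_algebra_def)

lemma alg_homs_compose:
  assumes "nonassoc_algebra F A" "\<phi> \<in> alg_homs F A B" "\<psi> \<in> alg_homs F B C"
  shows "compose (carrier A) \<psi> \<phi> \<in> alg_homs F A C"
proof -
  have "module F A" and mc: "\<And>x y. x \<in> carrier A \<Longrightarrow> y \<in> carrier A \<Longrightarrow> x \<otimes>\<^bsub>A\<^esub> y \<in> carrier A"
    using assms(1) by (auto simp: nonassoc_algebra_def)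
  then show ?thesis
    using lin_maps_compose[OF _ alg_homsD(1)[OF assms(2)] alg_homsD(1)[OF assms(3)]]
      lin_mapsD(1)[OF alg_homsD(1)[OF assms(2)]] alg_homsD(2)[OF assms(2)] alg_homsD(2)[OF assms(3)]
    by (auto simp: alg_homs_def compose_eq)
qed

text \<open>Arrows are meaningful only on carriers, so here and for composites the components must
  be known to lie in the carrier.\<close>

lemma grade_preserving_id:
  assumes "module F V" "direct_grading F T V"
  shows "grade_preserving T V V (restrict id (carrier V))"
  using direct_grading_subset[OF assms] by (auto simp: grade_preserving_def)

lemma grade_preserving_compose:
  assumes "module F U" "direct_grading F T U" "grade_preserving T U V \<phi>" "grade_preserving T V W \<psi>"
  shows "grade_preserving T U W (compose (carrier U) \<psi> \<phi>)"
  unfolding grade_preserving_def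
proof (intro ballI image_subsetI)
  fix t x assume t: "t \<in> T" and x: "x \<in> grade U t"
  have "\<phi> x \<in> grade V t" using assms(3) t x by (auto simp: grade_preserving_def)
  then have "\<psi> (\<phi> x) \<in> grade W t" using assms(4) t by (auto simp: grade_preserving_def)
  then show "compose (carrier U) \<psi> \<phi> x \<in> grade W t"
    using direct_grading_subset[OF assms(1,2) t] x by (auto simp: compose_eq)
qed

lemma category_Vect_gr:
  fixes F :: "('f, 'r) ring_scheme" and T :: "'t set"
  shows "is_category (Vect_gr F T :: (('f, 'u, 't) graded_module, 'u \<Rightarrow> 'u) cat)"
proof -
  have mod: "module F V" "direct_grading F T V" if "graded_space F T V" for V :: "('f, 'u, 't) graded_module"
    using that by (simp_all add: graded_space_def)
  show ?thesis
    unfolding is_category_def Vect_gr_def cat.simps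
    apply (intro conjI ballI)
    subgoal by (auto intro!: lin_maps_id grade_preserving_id mod)
    subgoal by (auto intro!: lin_maps_compose grade_preserving_compose mod)
    subgoal for X Y f by (auto intro!: compose_restrict_id[of f _ "carrier Y"] dest: lin_mapsD)
    subgoal for X Y f by (auto intro!: compose_restrict_id[of f _ "carrier Y"] dest: lin_mapsD)
    subgoal for W X Y Z f g h by (rule compose_assoc) (auto dest: lin_mapsD)
    done
qed

lemma category_NAAlg_pgr:
  fixes F :: "('f, 'r) ring_scheme" and T :: "'t set"
  shows "is_category (NAAlg_pgr F T :: (('f, 'u, 't) graded_module, 'u \<Rightarrow> 'u) cat)"
proof -
  have mod: "nonassoc_algebra F A" "module F A" "direct_grading F T A" if "pgr_algebra F T A"
    for A :: "('f, 'u, 't) graded_module"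
    using that by (simp_all add: pgr_algebra_def nonassoc_algebra_def)
  show ?thesis
    unfolding is_category_def NAAlg_pgr_def cat.simps
    apply (intro conjI ballI)
    subgoal by (auto intro!: alg_homs_id grade_preserving_id mod)
    subgoal by (auto intro!: alg_homs_compose grade_preserving_compose mod)
    subgoal for X Y f by (auto intro!: compose_restrict_id[of f _ "carrier Y"] dest!: alg_homsD(1) dest: lin_mapsD)
    subgoal for X Y f by (auto intro!: compose_restrict_id[of f _ "carrier Y"] dest!: alg_homsD(1) dest: lin_mapsD)
    subgoal for W X Y Z f g h by (rule compose_assoc) (auto dest!: alg_homsD(1) dest: lin_mapsD)
    done
qed

section \<open>The two functors\<close>

lemma U_obj_simps [simp]:
  "carrier (U_obj T A) = grade_total T A" "grade (U_obj T A) = grade A"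
  "\<zero>\<^bsub>U_obj T A\<^esub> = \<zero>\<^bsub>A\<^esub>" "add (U_obj T A) = add A" "smult (U_obj T A) = smult A"
  by (simp_all add: U_obj_def)

lemma graded_space_U_obj:
  assumes "module F A" "direct_grading F T A"
  shows "graded_space F T (U_obj T A)"
proof -
  interpret A: module F A by fact
  have sub: "\<And>t. t \<in> T \<Longrightarrow> submodule (grade A t) F A" using assms(2) by (auto simp: direct_grading_def)
  have tot: "submodule (grade_total T A) F A" by (rule submodule_grade_total[OF assms(1) sub])
  have U: "module F (U_obj T A)"
    using submodule.submodule_is_module[OF tot assms(1)] by (simp add: U_obj_def)
  interpret U: module F "U_obj T A" by (fact U)
  have subU: "submodule (grade (U_obj T A) t) F (U_obj T A)" if t: "t \<in> T" for t
    by (rule U.submoduleI_smult)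
       (use A.submoduleE[OF sub[OF t]] A.submodule_zero[OF sub[OF t]] grade_subset_total[OF assms(1) sub t] in auto)
  have fam: "grade_families T (U_obj T A) = grade_families T A" by (simp add: grade_families_def)
  \<comment> \<open>Linearity of the inclusion carries finite sums from the one structure to the
    other.\<close>
  have incl: "restrict id (grade_total T A) \<in> lin_maps F (U_obj T A) A"
    using lin_maps_restrictI[OF U, of id A] A.submoduleE(1)[OF tot] by auto
  \<comment> \<open>Not immediate: \<open>finsum\<close> depends on the carrier of the structure in which it is formed.\<close>
  have sum: "family_sum (U_obj T A) x = family_sum A x" if x: "x \<in> grade_families T A" for x
  proof -
    have x': "x \<in> grade_families T (U_obj T A)" using x fam by simp
    have cl: "x t \<in> grade_total T A" for t
      using grade_families_closed[OF U subU x'] by simp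
    \<comment> \<open>Only on \<open>grade_total T A\<close> does the restricted inclusion act as
      the identity.\<close>
    have "family_sum (U_obj T A) x \<in> grade_total T A"
      using U.submoduleE(1)[OF submodule_grade_total[OF U subU]] x' by (auto simp: grade_total_def)
    then show ?thesis
      using lin_maps_family_sum[OF U subU assms(1) incl x'] cl by simp
  qed
  have "inj_on (family_sum (U_obj T A)) (grade_families T (U_obj T A))"
    using assms(2) inj_on_cong[of "grade_families T A" "family_sum (U_obj T A)" "family_sum A"] sum
    by (simp add: fam direct_grading_def)
  moreover have "grade_total T (U_obj T A) = carrier (U_obj T A)"
    using sum by (simp add: grade_total_def fam)
  ultimately show ?thesis using U subU by (simp add: graded_space_def direct_grading_def)
qed

text \<open>Since \<open>V\<close> is the sum of its components, a grade preserving map into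
  \<open>A\<close> has its values in \<open>grade_total T A\<close>. Arrows into \<open>U A\<close>
  are therefore the same functions as grade preserving linear maps into \<open>A\<close>, and the
  adjunction can be proved with target \<open>A\<close>.\<close>

lemma lin_maps_U_obj:
  assumes V: "graded_space F T V" and A: "pgr_algebra F T A"
  shows "\<phi> \<in> lin_maps F V (U_obj T A) \<and> grade_preserving T V (U_obj T A) \<phi> \<longleftrightarrow>
    \<phi> \<in> lin_maps F V A \<and> grade_preserving T V A \<phi>"
proof -
  have mV: "module F V" and mA: "module F A"
    and sV: "\<And>t. t \<in> T \<Longrightarrow> submodule (grade V t) F V" and sA: "\<And>t. t \<in> T \<Longrightarrow> submodule (grade A t) F A"
    and tot: "carrier V = grade_total T V"
    using V A by (auto simp: graded_space_def pgr_algebra_def nonassoc_algebra_def direct_grading_def)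
  have "grade_total T A \<subseteq> carrier A" using module.submoduleE(1)[OF mA submodule_grade_total[OF mA sA]] .
  moreover have "\<phi> v \<in> grade_total T A"
    if "\<phi> \<in> lin_maps F V A" "grade_preserving T V A \<phi>" "v \<in> carrier V" for v
    using lin_maps_grade_total[OF mV sV mA that(1,2)] that(3) tot by simp
  ultimately show ?thesis
    by (auto simp: lin_maps_def grade_preserving_def PiE_def Pi_def)
qed

lemma functor_U:
  fixes F :: "('f, 'r) ring_scheme" and T :: "'t set"
  shows "is_functor (NAAlg_pgr F T :: (('f, 'u, 't) graded_module, 'u \<Rightarrow> 'u) cat) (Vect_gr F T) (U_functor T)"
proof -
  have mod: "nonassoc_algebra F A" "module F A" "direct_grading F T A"
    "\<And>t. t \<in> T \<Longrightarrow> submodule (grade A t) F A" if "pgr_algebra F T A"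
    for A :: "('f, 'u, 't) graded_module"
    using that by (simp_all add: pgr_algebra_def nonassoc_algebra_def direct_grading_def)
  have sub: "grade_total T A \<subseteq> carrier A" if "pgr_algebra F T A" for A :: "('f, 'u, 't) graded_module"
    using module.submoduleE(1)[OF mod(2)[OF that] submodule_grade_total[OF mod(2,4)[OF that]]] .
  \<comment> \<open>This makes the restriction of a homomorphism a map into
    \<open>U_obj T B\<close>, and makes restricted homomorphisms composable.\<close>
  have tot: "f x \<in> grade_total T B"
    if "pgr_algebra F T A" "pgr_algebra F T B" "f \<in> alg_homs F A B" "grade_preserving T A B f" "x \<in> grade_total T A"
    for A B :: "('f, 'u, 't) graded_module" and f x
    using lin_maps_grade_total[OF mod(2,4)[OF that(1)] mod(2)[OF that(2)] alg_homsD(1)[OF that(3)] that(4,5)] .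
  show ?thesis
    unfolding is_functor_def
  proof (intro conjI category_Vect_gr category_NAAlg_pgr ballI)
    fix A :: "('f, 'u, 't) graded_module" assume "A \<in> Obj (NAAlg_pgr F T)"
    then have A: "pgr_algebra F T A" by (simp add: NAAlg_pgr_def)
    show "on_obj (U_functor T) A \<in> Obj (Vect_gr F T)"
      using graded_space_U_obj[OF mod(2,3)[OF A]] by (simp add: Vect_gr_def U_functor_def)
    show "on_hom (U_functor T) A A (Ide (NAAlg_pgr F T) A) = Ide (Vect_gr F T) (on_obj (U_functor T) A)"
      using sub[OF A] by (auto simp: Vect_gr_def NAAlg_pgr_def U_functor_def restrict_def fun_eq_iff)
    fix B :: "('f, 'u, 't) graded_module" assume "B \<in> Obj (NAAlg_pgr F T)"
    then have B: "pgr_algebra F T B" by (simp add: NAAlg_pgr_def)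
    fix f assume "f \<in> Hom (NAAlg_pgr F T) A B"
    then have f: "f \<in> alg_homs F A B" "grade_preserving T A B f" by (simp_all add: NAAlg_pgr_def)
    have U: "module F (U_obj T A)" using graded_space_U_obj[OF mod(2,3)[OF A]] by (simp add: graded_space_def)
    have "restrict f (carrier (U_obj T A)) \<in> lin_maps F (U_obj T A) (U_obj T B)"
      by (rule lin_maps_restrictI[OF U])
         (use sub[OF A] tot[OF A B f] lin_mapsD[OF alg_homsD(1)[OF f(1)]] in \<open>auto simp: subset_iff\<close>)
    moreover have "grade_preserving T A B (restrict f (grade_total T A))"
      using f(2) grade_subset_total[OF mod(2,4)[OF A]] by (fastforce simp: grade_preserving_def)
    ultimately show "on_hom (U_functor T) A B f \<in> Hom (Vect_gr F T) (on_obj (U_functor T) A) (on_obj (U_functor T) B)"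
      by (simp add: Vect_gr_def U_functor_def grade_preserving_def)
    fix C :: "('f, 'u, 't) graded_module" assume "C \<in> Obj (NAAlg_pgr F T)"
    fix g assume "g \<in> Hom (NAAlg_pgr F T) B C"
    show "on_hom (U_functor T) A C (Comp (NAAlg_pgr F T) A B C g f) =
      Comp (Vect_gr F T) (on_obj (U_functor T) A) (on_obj (U_functor T) B) (on_obj (U_functor T) C)
        (on_hom (U_functor T) B C g) (on_hom (U_functor T) A B f)"
      using sub[OF A] tot[OF A B f]
      by (auto simp: Vect_gr_def NAAlg_pgr_def U_functor_def compose_def restrict_def fun_eq_iff)
  qed
qed

section \<open>The arrow part of \<open>K\<close> and the adjunction, for an injective
  coding\<close>

context
  fixes F :: "('f, 'r) ring_scheme" and T :: "'t set"
  assumes F: "field F"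
    and inj: "inj_on (encode F :: ('u bword \<Rightarrow> 'f) \<Rightarrow> 'u) (carrier (free_alg F UNIV))"
begin

context
  fixes V W :: "('f, 'u, 't) graded_module" and \<phi> :: "'u \<Rightarrow> 'u"
  assumes V: "graded_space F T V" and W: "graded_space F T W" and \<phi>: "\<phi> \<in> lin_maps F V W"
begin

text \<open>Uniqueness of extensions resolves the definite description. The functor laws follow by
  exhibiting the expected homomorphism and checking it on \<open>V\<close> only.\<close>

lemma K_hom_eqI:
  assumes "\<psi> \<in> alg_homs F (K_obj F T V) (K_obj F T W)"
    and "\<And>v. v \<in> carrier V \<Longrightarrow> \<psi> (K_incl F T V v) = K_incl F T W (\<phi> v)"
  shows "K_hom F T V W \<phi> = \<psi>"
  unfolding K_hom_def
  by (rule the_equality)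
     (use assms K_universal_unique[OF F inj V nonassoc_K_obj[OF F inj W]] in auto)

text \<open>The universal property of \<open>KV\<close>, applied to the composite of
  \<open>\<phi>\<close> with the inclusion of \<open>W\<close> into \<open>KW\<close>.\<close>

lemma K_hom:
  shows "K_hom F T V W \<phi> \<in> alg_homs F (K_obj F T V) (K_obj F T W)"
    and "v \<in> carrier V \<Longrightarrow> K_hom F T V W \<phi> (K_incl F T V v) = K_incl F T W (\<phi> v)"
proof -
  have "module F V" using V by (simp add: graded_space_def)
  then have "compose (carrier V) (restrict (K_incl F T W) (carrier W)) \<phi> \<in> lin_maps F V (K_obj F T W)"
    by (rule lin_maps_compose[OF _ \<phi> K_incl_linear[OF F inj W]])
  from K_universal_ex[OF F inj V nonassoc_K_obj[OF F inj W] this] obtain \<psi> where \<psi>: "\<psi> \<in> alg_homs F (K_obj F T V) (K_obj F T W)"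
    "\<And>v. v \<in> carrier V \<Longrightarrow> \<psi> (K_incl F T V v) = K_incl F T W (\<phi> v)"
    using lin_mapsD(1)[OF \<phi>] by (auto simp: compose_eq)
  then have "K_hom F T V W \<phi> = \<psi>" by (rule K_hom_eqI)
  then show "K_hom F T V W \<phi> \<in> alg_homs F (K_obj F T V) (K_obj F T W)"
    and "v \<in> carrier V \<Longrightarrow> K_hom F T V W \<phi> (K_incl F T V v) = K_incl F T W (\<phi> v)" using \<psi> by auto
qed

end

lemma functor_K:
  "is_functor (Vect_gr F T :: (('f, 'u, 't) graded_module, 'u \<Rightarrow> 'u) cat) (NAAlg_pgr F T) (K_functor F T)"
  unfolding is_functor_def
proof (intro conjI category_Vect_gr category_NAAlg_pgr ballI)
  fix V :: "('f, 'u, 't) graded_module" assume "V \<in> Obj (Vect_gr F T)"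
  then have V: "graded_space F T V" by (simp add: Vect_gr_def)
  note mV = graded_spaceD[OF V]
  show "on_obj (K_functor F T) V \<in> Obj (NAAlg_pgr F T)"
    using pgr_K_obj[OF F inj V] by (simp add: NAAlg_pgr_def K_functor_def)
  have "K_hom F T V V (restrict id (carrier V)) = restrict id (carrier (K_obj F T V))"
    by (rule K_hom_eqI[OF V V lin_maps_id[OF mV(1)] alg_homs_id[OF nonassoc_K_obj[OF F inj V]]])
       (simp add: K_incl_closed[OF F inj V])
  then show "on_hom (K_functor F T) V V (Ide (Vect_gr F T) V) = Ide (NAAlg_pgr F T) (on_obj (K_functor F T) V)"
    by (simp add: NAAlg_pgr_def Vect_gr_def K_functor_def)
  fix W :: "('f, 'u, 't) graded_module" assume "W \<in> Obj (Vect_gr F T)"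
  then have W: "graded_space F T W" by (simp add: Vect_gr_def)
  fix f assume "f \<in> Hom (Vect_gr F T) V W"
  then have f: "f \<in> lin_maps F V W" "grade_preserving T V W f" by (simp_all add: Vect_gr_def)
  note Kf = K_hom[OF V W f(1)]
  \<comment> \<open>The components of \<open>KV\<close> consist of degree 1 elements, on which
    \<open>K_hom\<close> acts as \<open>f\<close>.\<close>
  have "grade_preserving T (K_obj F T V) (K_obj F T W) (K_hom F T V W f)"
    unfolding grade_preserving_def
  proof (intro ballI image_subsetI)
    fix t x assume t: "t \<in> T" and "x \<in> grade (K_obj F T V) t"
    then obtain v where v: "v \<in> grade V t" "x = K_incl F T V v" by (auto simp: K_obj_simps)
    then have "K_hom F T V W f x = K_incl F T W (f v)" using Kf(2) mV(3)[OF t] by auto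
    then show "K_hom F T V W f x \<in> grade (K_obj F T W) t"
      using f(2) t v(1) by (auto simp: grade_preserving_def K_obj_simps)
  qed
  then show "on_hom (K_functor F T) V W f \<in> Hom (NAAlg_pgr F T) (on_obj (K_functor F T) V) (on_obj (K_functor F T) W)"
    using Kf(1) by (simp add: NAAlg_pgr_def K_functor_def)
  fix X :: "('f, 'u, 't) graded_module" assume "X \<in> Obj (Vect_gr F T)"
  then have X: "graded_space F T X" by (simp add: Vect_gr_def)
  fix g assume "g \<in> Hom (Vect_gr F T) W X"
  then have g: "g \<in> lin_maps F W X" by (simp add: Vect_gr_def)
  note Kg = K_hom[OF W X g]
  have "K_hom F T V X (compose (carrier V) g f) =
    compose (carrier (K_obj F T V)) (K_hom F T W X g) (K_hom F T V W f)"
    by (rule K_hom_eqI[OF V X lin_maps_compose[OF mV(1) f(1) g]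
          alg_homs_compose[OF nonassoc_K_obj[OF F inj V] Kf(1) Kg(1)]])
       (simp add: compose_eq K_incl_closed[OF F inj V] Kf(2) Kg(2) lin_mapsD(1)[OF f(1)])
  then show "on_hom (K_functor F T) V X (Comp (Vect_gr F T) V W X g f) =
    Comp (NAAlg_pgr F T) (on_obj (K_functor F T) V) (on_obj (K_functor F T) W) (on_obj (K_functor F T) X)
      (on_hom (K_functor F T) W X g) (on_hom (K_functor F T) V W f)"
    by (simp add: NAAlg_pgr_def Vect_gr_def K_functor_def)
qed

section \<open>The adjunction\<close>

lemma hom_K_bij:
  fixes V A :: "('f, 'u, 't) graded_module"
  assumes V: "graded_space F T V" and A: "pgr_algebra F T A"
  shows "bij_betw (\<lambda>h. compose (carrier V) h (K_incl F T V))
    {h \<in> alg_homs F (K_obj F T V) A. grade_preserving T (K_obj F T V) A h}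
    {\<phi> \<in> lin_maps F V (U_obj T A). grade_preserving T V (U_obj T A) \<phi>}"
proof -
  have nA: "nonassoc_algebra F A" using A by (simp add: pgr_algebra_def)
  note mV = graded_spaceD[OF V]
  have incl: "compose (carrier V) h (K_incl F T V) =
    compose (carrier V) h (restrict (K_incl F T V) (carrier V))" for h
    by (auto simp: compose_def restrict_def)
  \<comment> \<open>The components of \<open>KV\<close> are exactly the images of those of
    \<open>V\<close>, so preserving grades is tested on \<open>V\<close> alone. This gives the
    target condition for composites and the source condition for lifts at once.\<close>
  have gp: "grade_preserving T V A (compose (carrier V) h (K_incl F T V)) \<longleftrightarrow>
    grade_preserving T (K_obj F T V) A h" for h
    using mV(3) by (fastforce simp: grade_preserving_def K_obj_simps compose_eq)
  have lin: "compose (carrier V) h (K_incl F T V) \<in> lin_maps F V A" if "h \<in> alg_homs F (K_obj F T V) A" for h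
    unfolding incl using lin_maps_compose[OF mV(1) K_incl_linear[OF F inj V] alg_homsD(1)[OF that]] .
  have target: "{\<phi> \<in> lin_maps F V (U_obj T A). grade_preserving T V (U_obj T A) \<phi>} =
    {\<phi> \<in> lin_maps F V A. grade_preserving T V A \<phi>}"
    using lin_maps_U_obj[OF V A] by blast
  show ?thesis unfolding target
  proof (rule bij_betw_imageI)
    show "inj_on (\<lambda>h. compose (carrier V) h (K_incl F T V))
      {h \<in> alg_homs F (K_obj F T V) A. grade_preserving T (K_obj F T V) A h}"
      by (intro inj_onI K_universal_unique[OF F inj V nA]) (auto simp: compose_def restrict_def fun_eq_iff, metis)
    show "(\<lambda>h. compose (carrier V) h (K_incl F T V)) `
      {h \<in> alg_homs F (K_obj F T V) A. grade_preserving T (K_obj F T V) A h} =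
      {\<phi> \<in> lin_maps F V A. grade_preserving T V A \<phi>}"
    proof (intro equalityI subsetI)
      fix \<phi> assume "\<phi> \<in> {\<phi> \<in> lin_maps F V A. grade_preserving T V A \<phi>}"
      then have \<phi>: "\<phi> \<in> lin_maps F V A" "grade_preserving T V A \<phi>" by auto
      obtain h where h: "h \<in> alg_homs F (K_obj F T V) A" "\<And>v. v \<in> carrier V \<Longrightarrow> h (K_incl F T V v) = \<phi> v"
        using K_universal_ex[OF F inj V nA \<phi>(1)] by auto
      have "compose (carrier V) h (K_incl F T V) = \<phi>"
        by (rule extensionalityI[of _ "carrier V"]) (use h lin_mapsD(4)[OF \<phi>(1)] in \<open>auto simp: compose_eq\<close>)
      then show "\<phi> \<in> (\<lambda>h. compose (carrier V) h (K_incl F T V)) `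
        {h \<in> alg_homs F (K_obj F T V) A. grade_preserving T (K_obj F T V) A h}"
        using h(1) \<phi>(2) gp[of h] by auto
    qed (use lin gp in auto)
  qed
qed

lemma K_left_adjoint_U:
  "left_adjoint (Vect_gr F T :: (('f, 'u, 't) graded_module, 'u \<Rightarrow> 'u) cat) (NAAlg_pgr F T)
    (K_functor F T) (U_functor T)"
  unfolding left_adjoint_def
proof (intro conjI functor_K functor_U exI ballI)
  let ?\<Phi> = "\<lambda>V A h. compose (carrier V) h (K_incl F T V)"
  fix V A :: "('f, 'u, 't) graded_module"
  assume "V \<in> Obj (Vect_gr F T)" "A \<in> Obj (NAAlg_pgr F T)"
  then have V: "graded_space F T V" and A: "pgr_algebra F T A"
    by (simp_all add: Vect_gr_def NAAlg_pgr_def)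
  show "bij_betw (?\<Phi> V A) (Hom (NAAlg_pgr F T) (on_obj (K_functor F T) V) A)
      (Hom (Vect_gr F T) V (on_obj (U_functor T) A))"
    using hom_K_bij[OF V A] by (simp add: Vect_gr_def NAAlg_pgr_def K_functor_def U_functor_def)
next
  let ?\<Phi> = "\<lambda>V A h. compose (carrier V) h (K_incl F T V)"
  fix V V' A A' :: "('f, 'u, 't) graded_module" and f g h
  assume "V \<in> Obj (Vect_gr F T)" "V' \<in> Obj (Vect_gr F T)" "A \<in> Obj (NAAlg_pgr F T)" "A' \<in> Obj (NAAlg_pgr F T)"
    and "f \<in> Hom (Vect_gr F T) V' V" "g \<in> Hom (NAAlg_pgr F T) A A'"
    and "h \<in> Hom (NAAlg_pgr F T) (on_obj (K_functor F T) V) A"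
  then have V: "graded_space F T V" and V': "graded_space F T V'" and A: "pgr_algebra F T A"
    and f: "f \<in> lin_maps F V' V"
    and h: "h \<in> alg_homs F (K_obj F T V) A" "grade_preserving T (K_obj F T V) A h"
    by (simp_all add: Vect_gr_def NAAlg_pgr_def K_functor_def)
  have "?\<Phi> V A h \<in> lin_maps F V (U_obj T A)"
    using bij_betw_apply[OF hom_K_bij[OF V A], of h] h by simp
  \<comment> \<open>The functor \<open>U\<close> restricts \<open>g\<close> to
    \<open>grade_total T A\<close>; only there does its restriction agree with
    \<open>g\<close>.\<close>
  then have "h (K_incl F T V v) \<in> grade_total T A" if "v \<in> carrier V" for v
    using lin_mapsD(1)[of "?\<Phi> V A h" F V "U_obj T A" v] that by (simp add: compose_eq)
  \<comment> \<open>At \<open>v\<close> in \<open>V'\<close> both sides equal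
    \<open>g (h (K_incl F T V (f v)))\<close>, because \<open>K_hom\<close> extends
    \<open>f\<close>.\<close>
  then show "?\<Phi> V' A' (Comp (NAAlg_pgr F T) (on_obj (K_functor F T) V') A A' g
      (Comp (NAAlg_pgr F T) (on_obj (K_functor F T) V') (on_obj (K_functor F T) V) A h
        (on_hom (K_functor F T) V' V f))) =
    Comp (Vect_gr F T) V' (on_obj (U_functor T) A) (on_obj (U_functor T) A') (on_hom (U_functor T) A A' g)
      (Comp (Vect_gr F T) V' V (on_obj (U_functor T) A) (?\<Phi> V A h) f)"
    using K_incl_closed[OF F inj V'] lin_mapsD(1)[OF f] K_hom(2)[OF V' V f]
    by (auto simp: Vect_gr_def NAAlg_pgr_def K_functor_def U_functor_def compose_def restrict_def fun_eq_iff)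
qed

end

theorem proposition7p1:
  fixes F :: "('f, 'r) ring_scheme" and T :: "'t set"
  assumes "field F"
    and "infinite (UNIV :: 'u set)"
    and "carrier F \<lesssim> (UNIV :: 'u set)"
  shows "left_adjoint
    (Vect_gr F T :: (('f, 'u, 't) graded_module, 'u \<Rightarrow> 'u) cat)
    (NAAlg_pgr F T :: (('f, 'u, 't) graded_module, 'u \<Rightarrow> 'u) cat)
    (K_functor F T) (U_functor T)"
  using K_left_adjoint_U[OF assms(1) inj_encode[OF assms(2,3)]] .

end
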